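(* Let $d\ge1$. A basis $(\varphi_n)_{n=0}^\infty$ in the space $H(\mathbb{C}^d)$ of entire functions has the Global Bohr Property if and only if one of the functions $\varphi_n$ is a constant function.
   Context: $H(\mathbb{C}^d)$ is the space of entire functions on $\mathbb{C}^d$ with the topology of uniform convergence on compact sets. For a compact $K$, $|f|_K:=\sup_{z\in K}|f(z)|$. A sequence $(\varphi_n)_{n=0}^\infty$ is a basis of $H(\mathbb{C}^d)$ if every $f$ has a unique representation $f=\sum_{n=0}^\infty f_n\varphi_n$ with complex $f_n$, converging uniformly on compact sets. The basis has the Global Bohr Property (GBP) if for every compact $K\subset\mathbb{C}^d$ there is a compact $K_1\supset K$ such that for every $f=\sum_{n=0}^\infty f_n\varphi_n\in H(\mathbb{C}^d)$ one has $\sum_{n=0}^\infty |f_n|\,|\varphi_n|_K\le |f|_{K_1}$. *)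

theory Defs
  imports "HOL-Analysis.Analysis"
begin

text \<open>Points of C^d are vectors of type complex^'d, with 'd a finite (hence nonempty) index type,
so d = CARD('d) \<ge> 1.\<close>

text \<open>Entire (holomorphic) functions on C^d: complex (Frechet) differentiable at every point,
i.e. the real derivative exists and is complex-linear.\<close>
definition entire :: "(complex^'d \<Rightarrow> complex) \<Rightarrow> bool" where
  "entire f \<longleftrightarrow> (\<forall>z. \<exists>D. (f has_derivative D) (at z) \<and> (\<forall>(c::complex) v. D (c *s v) = c * D v))"

definition supnorm :: "(complex^'d) set \<Rightarrow> (complex^'d \<Rightarrow> complex) \<Rightarrow> real" where
  "supnorm K f = (if K = {} then 0 else (SUP z\<in>K. norm (f z)))"

definition represents :: "(nat \<Rightarrow> complex) \<Rightarrow> (nat \<Rightarrow> complex^'d \<Rightarrow> complex) \<Rightarrow> (complex^'d \<Rightarrow> complex) \<Rightarrow> bool" where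
  "represents c \<phi> f \<longleftrightarrow>
     (\<forall>K. compact K \<longrightarrow> uniform_limit K (\<lambda>N z. \<Sum>n<N. c n * \<phi> n z) f sequentially)"

definition is_basis :: "(nat \<Rightarrow> complex^'d \<Rightarrow> complex) \<Rightarrow> bool" where
  "is_basis \<phi> \<longleftrightarrow> (\<forall>n. entire (\<phi> n)) \<and> (\<forall>f. entire f \<longrightarrow> (\<exists>!c. represents c \<phi> f))"

definition global_bohr :: "(nat \<Rightarrow> complex^'d \<Rightarrow> complex) \<Rightarrow> bool" where
  "global_bohr \<phi> \<longleftrightarrow>
    (\<forall>K. compact K \<longrightarrow> (\<exists>K1. compact K1 \<and> K \<subseteq> K1 \<and>
       (\<forall>f c. entire f \<longrightarrow> represents c \<phi> f \<longrightarrow>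
          summable (\<lambda>n. norm (c n) * supnorm K (\<phi> n)) \<and>
          (\<Sum>n. norm (c n) * supnorm K (\<phi> n)) \<le> supnorm K1 f)))"

end

theory Submission
  imports Defs "HOL-Complex_Analysis.Conformal_Mappings"
begin

text \<open>If the property holds, write 1 as the sum of the c_n \<phi>_n and take for K a single point z:
then the sum of the |c_n \<phi>_n(z)| is at most 1, so every c_n \<phi>_n(z) is real, and a real-valued
entire function is constant.

Conversely, every basis is absolute (Dynin and Mityagin): for each ball of radius r there are s, C
with \<Sum> |f_n| |\<phi>_n|_r \<le> C |f|_s. The open mapping argument gives |f_n| |\<phi>_n|_R \<le> C |f|_s for
every R, so it suffices that \<Sum> |\<phi>_n|_r / |\<phi>_n|_R < \<infinity> for some R. This follows from nuclearity in
the following form. A function vanishing on a grid of mesh 1/m is O(m^(-p)) on the smaller ball,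
where p is as large as we please provided that R is large. If more n than there are grid points had
|\<phi>_n|_r > \<theta> |\<phi>_n|_R, some nonzero combination of these \<phi>_n would vanish on the grid, and the
coefficient estimate would force \<theta> to be small.

If \<phi>_k is constant, apply the absolute estimate to f - f(0), which is represented by the same
coefficients except the k-th one. By Borel-Caratheodory, |f - f(0)|_s is at most
2 s / (R - s) (|f|_R - |f(0)|), so for large R the sum is at most |f|_R - |f(0)|, and |f(0)| is just
what the k-th term may add.\<close>

section \<open>Entire functions of several variables\<close>

text \<open>A bound in place of a supremum: estimates can be stated before any boundedness is known,
  and for negative \<open>r\<close> they hold vacuously.\<close>

definition ball_le :: "real \<Rightarrow> (complex^'d \<Rightarrow> complex) \<Rightarrow> real \<Rightarrow> bool" where
  "ball_le r f b \<longleftrightarrow> (\<forall>z. norm z \<le> r \<longrightarrow> norm (f z) \<le> b)"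

lemma ball_leI: "(\<And>z. norm z \<le> r \<Longrightarrow> norm (f z) \<le> b) \<Longrightarrow> ball_le r f b"
  by (simp add: ball_le_def)

lemma ball_leD: "ball_le r f b \<Longrightarrow> norm z \<le> r \<Longrightarrow> norm (f z) \<le> b"
  by (simp add: ball_le_def)

lemma ball_le_mono: "ball_le r f b \<Longrightarrow> r' \<le> r \<Longrightarrow> b \<le> b' \<Longrightarrow> ball_le r' f b'"
  unfolding ball_le_def by (meson order_trans)

lemma ball_le_add: "ball_le r f a \<Longrightarrow> ball_le r g b \<Longrightarrow> ball_le r (\<lambda>z. f z + g z) (a + b)"
  unfolding ball_le_def by (meson add_mono norm_triangle_ineq order_trans)

lemma ball_le_diff: "ball_le r f a \<Longrightarrow> ball_le r g b \<Longrightarrow> ball_le r (\<lambda>z. f z - g z) (a + b)"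
  unfolding ball_le_def by (meson add_mono norm_triangle_ineq4 order_trans)

lemma ball_le_cmult: "ball_le r f a \<Longrightarrow> ball_le r (\<lambda>z. c * f z) (norm c * a)"
  unfolding ball_le_def by (simp add: norm_mult mult_left_mono)

lemma norm_vector_smult: "norm (c *s v) = norm c * norm (v :: complex^'d)"
  by (simp add: norm_vec_def L2_set_def norm_mult power_mult_distrib sum_distrib_left[symmetric]
      real_sqrt_mult)

section \<open>Algebra, continuity and local boundedness of entire functions\<close>

lemma entire_const: "entire (\<lambda>z. a)"
  unfolding entire_def by (intro allI exI[of _ "\<lambda>_. 0"]) auto

lemma entire_add:
  assumes "entire f" "entire g"
  shows "entire (\<lambda>z. f z + g z)"
  unfolding entire_def
proof
  fix z
  obtain D E where "(f has_derivative D) (at z)" "\<forall>c v. D (c *s v) = c * D v"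
    "(g has_derivative E) (at z)" "\<forall>c v. E (c *s v) = c * E v"
    using assms unfolding entire_def by metis
  then show "\<exists>D. ((\<lambda>z. f z + g z) has_derivative D) (at z) \<and> (\<forall>c v. D (c *s v) = c * D v)"
    by (intro exI[of _ "\<lambda>v. D v + E v"]) (auto intro: has_derivative_add simp: ring_distribs)
qed

lemma entire_cmult:
  assumes "entire f"
  shows "entire (\<lambda>z. a * f z)"
  unfolding entire_def
proof
  fix z
  obtain D where "(f has_derivative D) (at z)" "\<forall>c v. D (c *s v) = c * D v"
    using assms unfolding entire_def by metis
  then show "\<exists>D. ((\<lambda>z. a * f z) has_derivative D) (at z) \<and> (\<forall>c v. D (c *s v) = c * D v)"
    by (intro exI[of _ "\<lambda>v. a * D v"]) (auto intro!: derivative_eq_intros)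
qed

lemma entire_diff: "entire f \<Longrightarrow> entire g \<Longrightarrow> entire (\<lambda>z. f z - g z)"
  using entire_add[of f "\<lambda>z. (-1) * g z"] entire_cmult[of g "-1"] by simp

lemma entire_sum: "(\<And>i. i \<in> A \<Longrightarrow> entire (f i)) \<Longrightarrow> entire (\<lambda>z. \<Sum>i\<in>A. f i z)"
  by (induction A rule: infinite_finite_induct) (auto intro: entire_add entire_const)

lemma entire_continuous_on: "entire f \<Longrightarrow> continuous_on S f"
  unfolding entire_def
  by (meson continuous_at_imp_continuous_on has_derivative_continuous)

lemma entire_bounded_on_ball:
  assumes "entire f"
  obtains b where "b > 0" "ball_le r f b"
proof -
  have "bounded (f ` cball 0 r)"
    using assms by (intro compact_imp_bounded compact_continuous_image entire_continuous_on) auto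
  then show ?thesis
    using that unfolding ball_le_def bounded_pos by auto
qed

section \<open>Restriction to complex lines, Cauchy estimates and their consequences\<close>

lemma entire_line_deriv:
  fixes v :: "complex^'d"
  assumes "(f has_derivative D) (at (z + t *s v))" "\<forall>c w. D (c *s w) = c * D w"
  shows "((\<lambda>t. f (z + t *s v)) has_field_derivative D v) (at t)"
proof -
  have "bounded_linear (\<lambda>t::complex. t *s v)"
    by (rule bounded_linear_intro[of _ "norm v"])
       (auto simp: norm_vector_smult vec_eq_iff algebra_simps)
  then have "((\<lambda>t. z + t *s v) has_derivative (\<lambda>t. t *s v)) (at t)"
    by (auto intro!: derivative_eq_intros bounded_linear_imp_has_derivative)
  \<comment> \<open>Complex linearity of \<open>D\<close> turns the real derivative along the line
    into multiplication by \<open>D v\<close>.\<close>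
  from diff_chain_at[OF this assms(1)] show ?thesis
    using assms(2) unfolding has_field_derivative_def by (simp add: o_def mult_commute_abs)
qed

lemma entire_line_holomorphic:
  assumes "entire f"
  shows "(\<lambda>t. f (z + t *s v)) holomorphic_on S"
proof (rule holomorphic_onI)
  fix t
  obtain D where "(f has_derivative D) (at (z + t *s v))" "\<forall>c w. D (c *s w) = c * D w"
    using assms unfolding entire_def by metis
  from entire_line_deriv[OF this]
  show "(\<lambda>t. f (z + t *s v)) field_differentiable at t within S"
    using field_differentiable_at_within field_differentiable_def by blast
qed

text \<open>Cauchy's inequality on the complex line through \<open>z\<close> in the direction of
  \<open>v\<close>: the unit circle around \<open>z\<close> stays in the ball of radius
  \<open>r + 1\<close>, which explains the loss of 1 in the radius.\<close>

lemma entire_derivative_bound: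
  assumes f: "entire f" and b: "ball_le (r + 1) f b" and z: "norm z \<le> r"
    and D: "(f has_derivative D) (at z)" "\<forall>c w. D (c *s w) = c * D w"
  shows "norm (D v) \<le> b * norm v"
proof (cases "v = 0")
  case True
  then show ?thesis
    using D(2)[rule_format, of 0 v] by simp
next
  case False
  define u where "u = complex_of_real (inverse (norm v)) *s v"
  have u: "norm u = 1"
    using False by (simp add: u_def norm_vector_smult norm_inverse)
  define h where "h t = f (z + t *s u)" for t
  have hol: "h holomorphic_on S" for S
    unfolding h_def by (rule entire_line_holomorphic[OF f])
  have "(h has_field_derivative D u) (at 0)"
    unfolding h_def by (rule entire_line_deriv) (use D in auto)
  then have "D u = deriv h 0"
    by (simp add: DERIV_imp_deriv)
  moreover have "norm ((deriv ^^ 1) h 0) \<le> fact 1 * b / 1 ^ 1"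
  proof (rule Cauchy_inequality)
    fix t :: complex assume "cmod (0 - t) = 1"
    then have "norm (z + t *s u) \<le> r + 1"
      using norm_triangle_ineq[of z "t *s u"] z u by (simp add: norm_vector_smult)
    then show "cmod (h t) \<le> b"
      using b by (simp add: h_def ball_leD)
  qed (auto intro: hol holomorphic_on_imp_continuous_on)
  moreover have "v = complex_of_real (norm v) *s u"
    using False by (simp add: u_def vec_eq_iff)
  then have "D v = norm v * D u"
    using D(2) by metis
  ultimately show ?thesis
    by (simp add: norm_mult mult.commute[of b] mult_left_mono)
qed

lemma entire_Lipschitz_on_ball:
  assumes f: "entire f" and b: "ball_le (r + 1) f b" and z: "norm z \<le> r" "norm w \<le> r"
  shows "norm (f z - f w) \<le> b * norm (z - w)"
proof -
  obtain D where D: "\<And>z. (f has_derivative D z) (at z)" "\<And>z. \<forall>c w. D z (c *s w) = c * D z w"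
    using f unfolding entire_def by metis
  show ?thesis
  proof (rule differentiable_bound[of "cball 0 r" f D])
    fix x :: "complex^'a" assume x: "x \<in> cball 0 r"
    show "onorm (D x) \<le> b"
      by (rule onorm_le) (use entire_derivative_bound[OF f b _ D] x in auto)
  qed (use D z in \<open>auto intro: has_derivative_at_withinI\<close>)
qed

text \<open>Weierstrass's theorem. By \<open>entire_derivative_bound\<close>, being uniformly Cauchy
  on the ball of radius r + 1 makes the derivatives uniformly Cauchy on the ball of radius r, so
  limit and derivative may be exchanged; complex linearity survives the pointwise limit.\<close>

lemma entire_uniform_limit:
  fixes f :: "nat \<Rightarrow> complex^'d \<Rightarrow> complex"
  assumes f: "\<And>n. entire (f n)"
    and Cauchy: "\<And>r e. e > 0 \<Longrightarrow> \<exists>N. \<forall>m\<ge>N. \<forall>n\<ge>N. ball_le r (\<lambda>z. f m z - f n z) e"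
  obtains g where "entire g" "\<And>z. (\<lambda>n. f n z) \<longlonglongrightarrow> g z"
proof -
  have conv: "convergent (\<lambda>n. f n z)" for z
  proof (rule Cauchy_convergent, rule metric_CauchyI)
    fix e :: real assume "e > 0"
    with Cauchy[of "e/2" "norm z"] obtain N where
      "\<forall>m\<ge>N. \<forall>n\<ge>N. ball_le (norm z) (\<lambda>z. f m z - f n z) (e/2)" by auto
    with \<open>e > 0\<close> show "\<exists>M. \<forall>m\<ge>M. \<forall>n\<ge>M. dist (f m z) (f n z) < e"
      unfolding dist_norm ball_le_def
      by (metis field_sum_of_halves less_add_same_cancel1 half_gt_zero order.strict_trans1 order_refl)
  qed
  obtain D where D: "\<And>n z. (f n has_derivative D n z) (at z)"
    "\<And>n z. \<forall>c w. D n z (c *s w) = c * D n z w"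
    using f unfolding entire_def by metis
  have dd: "\<exists>N. \<forall>m\<ge>N. \<forall>n\<ge>N. \<forall>z. norm z \<le> r \<longrightarrow> (\<forall>v. norm (D m z v - D n z v) \<le> e * norm v)"
    if "e > 0" for r e
  proof -
    obtain N where N: "\<And>m n. m \<ge> N \<Longrightarrow> n \<ge> N \<Longrightarrow> ball_le (r + 1) (\<lambda>z. f m z - f n z) e"
      using Cauchy[OF \<open>e > 0\<close>, of "r + 1"] by auto
    show ?thesis
    proof (intro exI[of _ N] allI impI)
      fix m n :: nat and z v :: "complex^'d" assume mn: "m \<ge> N" "n \<ge> N" and z: "norm z \<le> r"
      have "((\<lambda>z. f m z - f n z) has_derivative (\<lambda>v. D m z v - D n z v)) (at z)"
        by (intro has_derivative_diff D)
      then show "norm (D m z v - D n z v) \<le> e * norm v"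
        by (intro entire_derivative_bound[OF entire_diff[OF f f] N[OF mn] z, where D = "\<lambda>v. D m z v - D n z v"])
           (simp_all add: D right_diff_distrib)
    qed
  qed
  have convD: "convergent (\<lambda>n. D n z v)" for z v
  proof (rule Cauchy_convergent, rule metric_CauchyI)
    fix e :: real assume "e > 0"
    \<comment> \<open>The 1 in the denominator covers \<open>v = 0\<close>.\<close>
    then have "e / (norm v + 1) > 0" by (simp add: add_nonneg_pos)
    from dd[OF this, of "norm z"] obtain N where N:
      "\<forall>m\<ge>N. \<forall>n\<ge>N. norm (D m z v - D n z v) \<le> e / (norm v + 1) * norm v" by blast
    have "e / (norm v + 1) * norm v < e"
      using \<open>e > 0\<close> by (simp add: pos_divide_less_eq add_nonneg_pos distrib_left)
    with N show "\<exists>M. \<forall>m\<ge>M. \<forall>n\<ge>M. dist (D m z v) (D n z v) < e"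
      unfolding dist_norm by (meson order.strict_trans1)
  qed
  define g where "g z = lim (\<lambda>n. f n z)" for z
  define D' where "D' z v = lim (\<lambda>n. D n z v)" for z v
  have g: "(\<lambda>n. f n z) \<longlonglongrightarrow> g z" for z
    unfolding g_def using conv convergent_LIMSEQ_iff by blast
  have D': "(\<lambda>n. D n z v) \<longlonglongrightarrow> D' z v" for z v
    unfolding D'_def using convD convergent_LIMSEQ_iff by blast
  have "entire g"
    unfolding entire_def
  proof
    fix z :: "complex^'d"
    \<comment> \<open>Convexity serves the exchange of limit and derivative; openness turns the
      derivative within this set into a full derivative at \<open>z\<close>.\<close>
    let ?S = "ball 0 (norm z + 1) :: (complex^'d) set"
    have "\<exists>h. \<forall>x\<in>?S. (\<lambda>n. f n x) \<longlonglongrightarrow> h x \<and> (h has_derivative D' x) (at x within ?S)"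
    proof (rule has_derivative_sequence)
      fix e :: real assume "e > 0"
      then obtain N where N: "\<forall>m\<ge>N. \<forall>n\<ge>N. \<forall>x. norm x \<le> norm z + 1 \<longrightarrow>
          (\<forall>v. norm (D m x v - D n x v) \<le> e * norm v)" using dd by blast
      have "norm (D n x v - D' x v) \<le> e * norm v" if "n \<ge> N" "x \<in> ?S" for n x v
      proof (rule Lim_bounded)
        show "(\<lambda>m. norm (D n x v - D m x v)) \<longlonglongrightarrow> norm (D n x v - D' x v)"
          by (intro tendsto_intros D')
        show "\<forall>m\<ge>N. norm (D n x v - D m x v) \<le> e * norm v"
          using N that by auto
      qed
      then show "\<forall>\<^sub>F n in sequentially. \<forall>x\<in>?S. \<forall>h. norm (D n x h - D' x h) \<le> e * norm h"
        unfolding eventually_sequentially by blast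
    next
      show "0 \<in> ?S" by (simp add: add_nonneg_pos)
      show "(\<lambda>n. f n 0) \<longlonglongrightarrow> g 0" by (rule g)
    qed (use D in \<open>auto intro: has_derivative_at_withinI\<close>)
    then obtain h where h: "\<And>x. x \<in> ?S \<Longrightarrow> (\<lambda>n. f n x) \<longlonglongrightarrow> h x"
       "\<And>x. x \<in> ?S \<Longrightarrow> (h has_derivative D' x) (at x within ?S)" by blast
    have hg: "\<And>x. x \<in> ?S \<Longrightarrow> h x = g x"
      using h(1) g LIMSEQ_unique by blast
    have z: "z \<in> ?S" by simp
    have "(g has_derivative D' z) (at z within ?S)"
      using h(2)[OF z] has_derivative_transform[OF z, of g h] hg by metis
    then have "(g has_derivative D' z) (at z)"
      using at_within_open[OF z] by simp
    moreover have "D' z (c *s v) = c * D' z v" for c v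
    proof (rule LIMSEQ_unique[OF D'])
      show "(\<lambda>n. D n z (c *s v)) \<longlonglongrightarrow> c * D' z v"
        using tendsto_mult[OF tendsto_const D', of c z v] by (simp add: D)
    qed
    ultimately show "\<exists>D. (g has_derivative D) (at z) \<and> (\<forall>c v. D (c *s v) = c * D v)"
      by blast
  qed
  with g that show ?thesis by blast
qed

text \<open>The imaginary part of \<open>D v\<close> vanishes for every \<open>v\<close>; for
  \<open>\<i> *s v\<close> this says that the real part of \<open>D v\<close> vanishes too. So all
  derivatives are 0.\<close>

lemma real_valued_entire_constant:
  assumes f: "entire f" and re: "\<And>z. f z \<in> \<real>"
  shows "f z = f w"
proof -
  have "(f has_derivative (\<lambda>v. 0)) (at x)" for x
  proof -
    obtain D where D: "(f has_derivative D) (at x)" "\<forall>c v. D (c *s v) = c * D v"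
      using f unfolding entire_def by metis
    have "((\<lambda>z. Im (f z)) has_derivative (\<lambda>v. Im (D v))) (at x)"
      using D(1) by (rule bounded_linear.has_derivative[OF bounded_linear_Im])
    moreover have "(\<lambda>z. Im (f z)) = (\<lambda>z. 0)"
      using re by (auto simp: complex_is_Real_iff)
    ultimately have "(\<lambda>v. Im (D v)) = (\<lambda>v. 0)"
      using has_derivative_unique[OF _ has_derivative_const[of 0 "at x"]] by metis
    then have Im: "Im (D v) = 0" for v by metis
    have "D v = 0" for v
      using Im[of v] Im[of "\<i> *s v"] D(2) by (simp add: complex_eq_iff)
    then have "D = (\<lambda>v. 0)" by auto
    with D(1) show ?thesis by simp
  qed
  then show ?thesis
    using has_derivative_zero_unique[of UNIV f] by auto
qed

text \<open>The one-variable proof on the complex line through 0 and \<open>z\<close>: a function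
  \<open>g\<close> with g(0) = 0 and real part below A on the disc gives g / (2 A - g), which maps
  the disc into itself and vanishes at 0, so Schwarz's lemma applies.\<close>

lemma Borel_Caratheodory_entire:
  assumes f: "entire f" and b: "ball_le R f b" and sR: "0 \<le> s" "s < R"
  shows "ball_le s (\<lambda>z. f z - f 0) (2 * s / (R - s) * (b - norm (f 0)))"
proof (rule ball_leI)
  fix z :: "complex^'a" assume z: "norm z \<le> s"
  have R: "R > 0" using sR by simp
  have b0: "norm (f 0) \<le> b" using ball_leD[OF b, of 0] R by simp
  \<comment> \<open>The rotation by \<open>u\<close> makes the value at 0 equal to
    \<open>norm (f 0)\<close>; subtracting it lowers the bound \<open>b\<close> on the real part to
    \<open>b - norm (f 0)\<close>.\<close>
  define u where "u = (if f 0 = 0 then 1 else cnj (f 0) / norm (f 0))"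
  have u: "norm u = 1" "u * f 0 = norm (f 0)"
    by (auto simp: u_def norm_divide complex_norm_square[symmetric] power2_eq_square
        mult.commute[of "cnj _"])
  \<comment> \<open>The strict inequality keeps \<open>A\<close> positive even if
    \<open>b = norm (f 0)\<close>; a limit at the end removes it.\<close>
  have *: "norm (f z - f 0) \<le> 2 * s / (R - s) * A" if A: "A > b - norm (f 0)" for A
  proof (cases "z = 0")
    case True
    have "A \<ge> 0" using A b0 by simp
    with True show ?thesis using sR by simp
  next
    case False
    have A0: "A > 0" using A b0 by simp
    \<comment> \<open>With this scaling the closed unit disc in \<open>t\<close> stays in the ball
      of radius \<open>R\<close>, and \<open>z\<close> is reached at
      \<open>t = norm z / R\<close>.\<close>
    define v where "v = complex_of_real (R / norm z) *s z"
    have v: "norm v = R" using False R by (simp add: v_def norm_vector_smult norm_divide)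
    define g where "g t = u * f (0 + t *s v) - norm (f 0)" for t
    have Reg: "Re (g t) < A" if "norm t \<le> 1" for t
    proof -
      have "norm (t *s v) \<le> R"
        using that R by (simp add: norm_vector_smult v mult_left_le_one_le)
      then have "norm (u * f (0 + t *s v)) \<le> b"
        using ball_leD[OF b] u by (simp add: norm_mult)
      then show ?thesis
        unfolding g_def using complex_Re_le_cmod[of "u * f (0 + t *s v)"] A
        by (simp only: minus_complex.sel Re_complex_of_real)
    qed
    have lt: "norm (g t) < norm (2 * A - g t)" if "norm t \<le> 1" for t
    proof -
      have "(norm (2 * A - g t))\<^sup>2 - (norm (g t))\<^sup>2 = 4 * A * (A - Re (g t))"
        unfolding cmod_power2 by (simp add: algebra_simps power2_eq_square)
      also have "\<dots> > 0" using Reg[OF that] A0 by simp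
      finally show ?thesis
        by (simp add: power2_less_imp_less)
    qed
    have nz: "of_real (2 * A) - g t \<noteq> 0" if "norm t \<le> 1" for t
      using lt[OF that] by (metis norm_not_less_zero norm_zero)
    define F where "F t = g t / (2 * A - g t)" for t
    have F: "norm (F \<xi>) \<le> norm \<xi>" if "norm \<xi> < 1" for \<xi>
    proof (rule Schwarz_Lemma(1)[OF _ _ _ that])
      show "F holomorphic_on ball 0 1"
        unfolding F_def g_def
        by (intro holomorphic_intros entire_line_holomorphic f) (use nz in \<open>simp add: g_def\<close>)
      show "F 0 = 0" using u by (simp add: F_def g_def)
      show "norm (F t) < 1" if "norm t < 1" for t
        using lt[of t] that by (auto simp: F_def norm_divide divide_less_eq)
    qed
    define \<rho> where "\<rho> = norm z / R"
    have \<rho>: "0 \<le> \<rho>" "\<rho> \<le> s / R" "\<rho> < 1" using z sR R by (auto simp: \<rho>_def divide_right_mono)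
    have Fr: "norm (F (of_real \<rho>)) \<le> \<rho>"
      using F[of "of_real \<rho>"] \<rho> by simp
    have "of_real \<rho> *s v = z"
      using False R by (simp add: v_def \<rho>_def vec_eq_iff)
    then have g\<rho>: "g (of_real \<rho>) = u * (f z - f 0)"
      using u by (simp add: g_def right_diff_distrib)
    have "norm (g \<rho>) = norm (F \<rho>) * norm (2 * A - g \<rho>)"
      using lt[of "\<rho>"] \<rho> by (auto simp: F_def norm_divide)
    also have "\<dots> \<le> \<rho> * (2 * A + norm (g \<rho>))"
      using Fr norm_triangle_ineq4[of "2 * of_real A" "g \<rho>"] A0 \<rho>
      by (intro mult_mono) (auto simp: norm_mult)
    finally have "norm (g \<rho>) * (1 - \<rho>) \<le> 2 * A * \<rho>" by (simp add: algebra_simps)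
    also have "\<dots> \<le> 2 * A * (s / R)" using \<rho> A0 by (intro mult_left_mono) auto
    finally have 1: "norm (g \<rho>) * (1 - \<rho>) \<le> 2 * A * (s / R)" .
    have "norm (g \<rho>) * (1 - s / R) \<le> norm (g \<rho>) * (1 - \<rho>)"
      using \<rho> by (intro mult_left_mono) auto
    with 1 have "norm (g \<rho>) * (1 - s / R) \<le> 2 * A * (s / R)" by simp
    moreover have "1 - s / R = (R - s) / R" using R by (simp add: diff_divide_distrib)
    ultimately have "norm (g \<rho>) * (R - s) / R \<le> 2 * A * s / R" by simp
    then have "norm (g \<rho>) * (R - s) \<le> 2 * A * s" using R by (simp add: divide_le_cancel)
    then have "norm (g \<rho>) \<le> 2 * s / (R - s) * A"
      using sR by (simp add: pos_le_divide_eq mult_ac)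
    then show ?thesis by (simp add: g\<rho> norm_mult u)
  qed
  have "(\<lambda>k. 2 * s / (R - s) * (b - norm (f 0) + inverse (real (Suc k)))) \<longlonglongrightarrow>
      2 * s / (R - s) * (b - norm (f 0) + 0)"
    by (intro tendsto_intros LIMSEQ_inverse_real_of_nat)
  then show "norm (f z - f 0) \<le> 2 * s / (R - s) * (b - norm (f 0))"
    using * by (intro LIMSEQ_le_const) auto
qed

section \<open>Comparison of bounds on balls with supremum norms\<close>

lemma ball_le_supnorm:
  assumes "entire f" "r \<ge> 0"
  shows "ball_le r f (supnorm (cball 0 r) f)"
proof (rule ball_leI)
  fix z :: "complex^'a" assume z: "norm z \<le> r"
  have "compact ((\<lambda>z. norm (f z)) ` cball 0 r)"
    by (intro compact_continuous_image continuous_on_norm entire_continuous_on assms) auto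
  then have "bdd_above ((\<lambda>z. norm (f z)) ` cball 0 r)"
    by (intro bounded_imp_bdd_above compact_imp_bounded)
  with z have "norm (f z) \<le> (SUP z\<in>cball 0 r. norm (f z))"
    by (intro cSUP_upper) auto
  with assms(2) show "norm (f z) \<le> supnorm (cball 0 r) f" by (simp add: supnorm_def)
qed

lemma supnorm_le:
  assumes "ball_le r f b" "K \<subseteq> cball 0 r" "b \<ge> 0"
  shows "supnorm K f \<le> b"
  using assms by (auto simp: supnorm_def ball_le_def intro!: cSUP_least)

lemma supnorm_nonneg: "entire f \<Longrightarrow> r \<ge> 0 \<Longrightarrow> supnorm (cball 0 r) f \<ge> 0"
  using ball_leD[OF ball_le_supnorm, of f r 0] norm_ge_zero[of "f 0"] by (simp, linarith)

section \<open>Expansions and the Baire category argument\<close>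

lemma represents_iff_ball:
  "represents c \<phi> f \<longleftrightarrow>
    (\<forall>r. \<forall>e>0. \<exists>N0. \<forall>N\<ge>N0. ball_le r (\<lambda>z. (\<Sum>n<N. c n * \<phi> n z) - f z) e)"
proof (intro iffI allI impI)
  fix r e :: real
  assume "represents c \<phi> f" "e > 0"
  then have "\<forall>\<^sub>F N in sequentially. \<forall>z\<in>cball 0 r. dist (\<Sum>n<N. c n * \<phi> n z) (f z) < e"
    unfolding represents_def by (auto intro: uniform_limitD)
  then show "\<exists>N0. \<forall>N\<ge>N0. ball_le r (\<lambda>z. (\<Sum>n<N. c n * \<phi> n z) - f z) e"
    unfolding eventually_sequentially ball_le_def dist_norm
    by (metis less_imp_le mem_cball_0)
next
  assume *: "\<forall>r. \<forall>e>0. \<exists>N0. \<forall>N\<ge>N0. ball_le r (\<lambda>z. (\<Sum>n<N. c n * \<phi> n z) - f z) e"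
  show "represents c \<phi> f"
    unfolding represents_def
  proof (intro allI impI uniform_limitI)
    fix K :: "(complex^'a) set" and e :: real
    assume "compact K" "e > 0"
    then obtain r where r: "\<And>z. z \<in> K \<Longrightarrow> norm z \<le> r"
      using compact_imp_bounded bounded_iff by metis
    obtain N0 where N0: "\<And>N. N \<ge> N0 \<Longrightarrow> ball_le r (\<lambda>z. (\<Sum>n<N. c n * \<phi> n z) - f z) (e/2)"
      using * \<open>e > 0\<close> by (meson half_gt_zero)
    have "dist (\<Sum>n<N. c n * \<phi> n z) (f z) < e" if "N \<ge> N0" "z \<in> K" for N z
      using ball_leD[OF N0[OF that(1)] r[OF that(2)]] \<open>e > 0\<close> by (simp add: dist_norm)
    then show "\<forall>\<^sub>F N in sequentially. \<forall>z\<in>K. dist (\<Sum>n<N. c n * \<phi> n z) (f z) < e"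
      unfolding eventually_sequentially by blast
  qed
qed

lemma represents_sums:
  assumes "represents c \<phi> f"
  shows "(\<lambda>n. c n * \<phi> n z) sums f z"
proof -
  have "compact {z}" by simp
  then have "uniform_limit {z} (\<lambda>N z. \<Sum>n<N. c n * \<phi> n z) f sequentially"
    using assms unfolding represents_def by blast
  then show ?thesis
    unfolding sums_def by (rule tendsto_uniform_limitI) simp
qed

lemma represents_finite:
  assumes "finite F" "\<And>n. n \<notin> F \<Longrightarrow> c n = 0"
  shows "represents c \<phi> (\<lambda>z. \<Sum>n\<in>F. c n * \<phi> n z)"
  unfolding represents_iff_ball
proof (intro allI impI)
  fix r e :: real assume "e > 0"
  obtain N0 where "F \<subseteq> {..<N0}" using assms(1) finite_nat_iff_bounded by blast
  then have "(\<Sum>n<N. c n * \<phi> n z) = (\<Sum>n\<in>F. c n * \<phi> n z)" if "N \<ge> N0" for N z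
    using that assms by (intro sum.mono_neutral_right) auto
  then show "\<exists>N0. \<forall>N\<ge>N0. ball_le r (\<lambda>z. (\<Sum>n<N. c n * \<phi> n z) - (\<Sum>n\<in>F. c n * \<phi> n z)) e"
    using \<open>e > 0\<close> by (intro exI[of _ N0]) (simp add: ball_le_def)
qed

lemma represents_add:
  assumes "represents c \<phi> f" "represents d \<phi> g"
  shows "represents (\<lambda>n. c n + d n) \<phi> (\<lambda>z. f z + g z)"
  using assms unfolding represents_def
  by (simp add: ring_distribs sum.distrib uniform_limit_add)

lemma represents_cmult:
  assumes "represents c \<phi> f"
  shows "represents (\<lambda>n. a * c n) \<phi> (\<lambda>z. a * f z)"
  using assms unfolding represents_def
  by (simp add: mult.assoc sum_distrib_left[symmetric]
      bounded_linear.uniform_limit[OF bounded_linear_mult_right])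

lemma represents_diff:
  assumes "represents c \<phi> f" "represents d \<phi> g"
  shows "represents (\<lambda>n. c n - d n) \<phi> (\<lambda>z. f z - g z)"
  using represents_add[OF assms(1) represents_cmult[OF assms(2), of "-1"]] by simp

lemma represents_sum:
  assumes "\<And>i. i \<in> I \<Longrightarrow> represents (c i) \<phi> (f i)"
  shows "represents (\<lambda>n. \<Sum>i\<in>I. c i n) \<phi> (\<lambda>z. \<Sum>i\<in>I. f i z)"
  using assms
proof (induction I rule: infinite_finite_induct)
  case (insert i I)
  then show ?case by (simp add: represents_add)
qed (use represents_finite[of "{}" "\<lambda>_. 0"] in auto)

text \<open>For a basis, \<open>a\<close> bounds the seminorm sup_N |S_N f|_r, where S_N f are the
  partial sums. The open mapping argument is to show that this seminorm is continuous.\<close>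

definition partial_sums_le ::
    "(nat \<Rightarrow> complex^'d \<Rightarrow> complex) \<Rightarrow> real \<Rightarrow> real \<Rightarrow> (complex^'d \<Rightarrow> complex) \<Rightarrow> bool" where
  "partial_sums_le \<phi> r a f \<longleftrightarrow>
    (\<exists>c. represents c \<phi> f \<and> (\<forall>N. ball_le r (\<lambda>z. \<Sum>n<N. c n * \<phi> n z) a))"

lemma partial_sums_le_mono:
  "partial_sums_le \<phi> r a f \<Longrightarrow> r' \<le> r \<Longrightarrow> a \<le> a' \<Longrightarrow> partial_sums_le \<phi> r' a' f"
  unfolding partial_sums_le_def by (blast intro: ball_le_mono)

lemma partial_sums_le_diff:
  assumes "partial_sums_le \<phi> r a f" "partial_sums_le \<phi> r b g"
  shows "partial_sums_le \<phi> r (a + b) (\<lambda>z. f z - g z)"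
proof -
  obtain c d where c: "represents c \<phi> f" "\<And>N. ball_le r (\<lambda>z. \<Sum>n<N. c n * \<phi> n z) a"
    using assms(1) unfolding partial_sums_le_def by blast
  obtain d where d: "represents d \<phi> g" "\<And>N. ball_le r (\<lambda>z. \<Sum>n<N. d n * \<phi> n z) b"
    using assms(2) unfolding partial_sums_le_def by blast
  show ?thesis
    unfolding partial_sums_le_def
    using represents_diff[OF c(1) d(1)] ball_le_diff[OF c(2) d(2)]
    by (intro exI[of _ "\<lambda>n. c n - d n"] conjI allI) (simp_all add: left_diff_distrib sum_subtractf)
qed

lemma partial_sums_le_cmult:
  assumes "partial_sums_le \<phi> r a f"
  shows "partial_sums_le \<phi> r (norm x * a) (\<lambda>z. x * f z)"
proof -
  obtain c where c: "represents c \<phi> f" "\<And>N. ball_le r (\<lambda>z. \<Sum>n<N. c n * \<phi> n z) a"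
    using assms unfolding partial_sums_le_def by blast
  show ?thesis
    unfolding partial_sums_le_def
    using represents_cmult[OF c(1)] ball_le_cmult[OF c(2), of x]
    by (intro exI[of _ "\<lambda>n. x * c n"]) (simp add: mult.assoc sum_distrib_left)
qed

text \<open>The supremum norms over balls make the entire functions a Frechet space; the nested balls of
the Baire argument are those of radius e around f in the norm of radius s.\<close>
lemma Baire_entire:
  fixes V :: "nat \<Rightarrow> (complex^'d \<Rightarrow> complex) set"
  assumes V: "\<And>f. entire f \<Longrightarrow> \<exists>k. f \<in> V k"
  obtains k f0 s e where "entire f0" "e > 0"
    "\<And>f t \<eta>. entire f \<Longrightarrow> ball_le s (\<lambda>z. f z - f0 z) e \<Longrightarrow> \<eta> > 0 \<Longrightarrow>
       \<exists>g\<in>V k. ball_le t (\<lambda>z. f z - g z) \<eta>"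
proof (rule ccontr)
  assume neg: "\<not> thesis"
  note main = that
  \<comment> \<open>If the conclusion fails, every ball contains some \<open>f\<close> that has a
    whole neighbourhood free of \<open>V k\<close>.\<close>
  have step: "\<exists>f t \<eta>. entire f \<and> ball_le s (\<lambda>z. f z - f0 z) e \<and> \<eta> > 0 \<and>
      (\<forall>g\<in>V k. \<not> ball_le t (\<lambda>z. f z - g z) \<eta>)" if "entire f0" "e > 0" for k f0 s e
  proof (rule ccontr)
    assume "\<not> ?thesis"
    then have "\<exists>g\<in>V k. ball_le t (\<lambda>z. f z - g z) \<eta>"
      if "entire f" "ball_le s (\<lambda>z. f z - f0 z) e" "\<eta> > 0" for f t \<eta>
      using that by blast
    with neg main[OF that, of s k] show False by blast
  qed
  \<comment> \<open>The radii tend to infinity and the tolerances to 0, so the centres will converge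
    uniformly on every ball.\<close>
  define P :: "nat \<Rightarrow> (complex^'d \<Rightarrow> complex) \<times> real \<times> real \<Rightarrow> bool" where
    "P = (\<lambda>n (f, s, e). entire f \<and> e > 0 \<and> s \<ge> n \<and> e \<le> (1/2)^n)"
  \<comment> \<open>Moving the centre by at most \<open>e/2\<close> while at least halving the
    tolerance keeps each ball inside the previous one; the new ball misses
    \<open>V n\<close>.\<close>
  define Q :: "nat \<Rightarrow> (complex^'d \<Rightarrow> complex) \<times> real \<times> real \<Rightarrow>
      (complex^'d \<Rightarrow> complex) \<times> real \<times> real \<Rightarrow> bool" where
    "Q = (\<lambda>n (f, s, e) (f', s', e'). ball_le s (\<lambda>z. f' z - f z) (e/2) \<and> s \<le> s' \<and> e' \<le> e/2 \<and>
      (\<forall>g\<in>V n. \<not> ball_le s' (\<lambda>z. f' z - g z) e'))"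
  have "\<exists>x. \<forall>n. P n (x n) \<and> Q n (x n) (x (Suc n))"
  proof (rule dependent_nat_choice)
    show "\<exists>x. P 0 x"
      by (rule exI[of _ "(\<lambda>_. 0, 0, 1)"]) (simp add: P_def entire_const)
  next
    fix x n assume Px: "P n x"
    obtain f s e where x: "x = (f, s, e)" by (cases x)
    with Px have f: "entire f" "e > 0" "s \<ge> n" "e \<le> (1/2)^n" by (auto simp: P_def)
    obtain f' t \<eta> where f': "entire f'" "ball_le s (\<lambda>z. f' z - f z) (e/2)" "\<eta> > 0"
      "\<And>g. g \<in> V n \<Longrightarrow> \<not> ball_le t (\<lambda>z. f' z - g z) \<eta>"
      using step[of f "e/2" s n] f by auto
    show "\<exists>y. P (Suc n) y \<and> Q n x y"
    proof (intro exI conjI)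
      show "P (Suc n) (f', max (s + 1) t, min \<eta> (e/2))"
        using f f' by (auto simp: P_def)
      show "Q n x (f', max (s + 1) t, min \<eta> (e/2))"
        using f f' unfolding Q_def x by (auto dest: ball_le_mono[where r' = t and b' = \<eta>])
    qed
  qed
  then obtain x where x: "\<And>n. P n (x n)" "\<And>n. Q n (x n) (x (Suc n))" by blast
  define f s e where "f n = fst (x n)" and "s n = fst (snd (x n))" and "e n = snd (snd (x n))" for n
  have x_eq: "x n = (f n, s n, e n)" for n by (simp add: f_def s_def e_def)
  have f: "entire (f n)" "e n > 0" "s n \<ge> n" "e n \<le> (1/2)^n" for n
    using x(1)[of n] by (auto simp: P_def x_eq)
  have Q: "ball_le (s n) (\<lambda>z. f (Suc n) z - f n z) (e n / 2)" "s n \<le> s (Suc n)"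
      "e (Suc n) \<le> e n / 2" "\<And>g. g \<in> V n \<Longrightarrow> \<not> ball_le (s (Suc n)) (\<lambda>z. f (Suc n) z - g z) (e (Suc n))"
    for n using x(2)[of n] by (auto simp: Q_def x_eq)
  \<comment> \<open>The bound telescopes: a move by \<open>e m / 2\<close> is at most
    \<open>e m - e (Suc m)\<close>.\<close>
  have nest: "s n \<le> s m \<and> ball_le (s n) (\<lambda>z. f m z - f n z) (e n - e m)" if "n \<le> m" for n m
    using that
  proof (induction rule: dec_induct)
    case base
    show ?case by (simp add: ball_le_def)
  next
    case (step m)
    have "ball_le (s n) (\<lambda>z. f (Suc m) z - f m z) (e m / 2)"
      using Q(1)[of m] step.IH ball_le_mono by blast
    from ball_le_add[OF conjunct2[OF step.IH] this] show ?case
      using Q(2,3)[of m] step.IH by (auto intro: ball_le_mono)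
  qed
  have close: "ball_le (s n) (\<lambda>z. f m z - f n z) (e n)" if "n \<le> m" for n m
    using nest[OF that] f(2)[of m] by (auto intro: ball_le_mono)
  have "\<exists>N. \<forall>m\<ge>N. \<forall>n\<ge>N. ball_le r (\<lambda>z. f m z - f n z) \<epsilon>" if eps: "\<epsilon> > 0" for r \<epsilon>
  proof -
    obtain N1 where N1: "(1/2)^N1 < \<epsilon>/2"
      using real_arch_pow_inv[of "\<epsilon>/2" "1/2"] eps by auto
    obtain N2 where N2: "real N2 \<ge> r" using real_arch_simple by blast
    define N where "N = max N1 N2"
    have "(1/2)^N \<le> (1/2::real)^N1" by (rule power_decreasing) (auto simp: N_def)
    then have eN: "e N + e N \<le> \<epsilon>" using N1 f(4)[of N] by linarith
    have sN: "r \<le> s N" using N2 f(3)[of N] by (simp add: N_def)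
    show ?thesis
    proof (intro exI[of _ N] allI impI)
      fix m n assume "m \<ge> N" "n \<ge> N"
      from ball_le_diff[OF close[OF this(1)] close[OF this(2)]]
      show "ball_le r (\<lambda>z. f m z - f n z) \<epsilon>"
        using eN sN by (auto intro: ball_le_mono)
    qed
  qed
  from entire_uniform_limit[OF f(1) this]
  obtain g where g: "entire g" "\<And>z. (\<lambda>n. f n z) \<longlonglongrightarrow> g z" by blast
  obtain k where k: "g \<in> V k" using V g(1) by blast
  \<comment> \<open>The limit \<open>g\<close> lies in all the balls, hence also in the one chosen
    to miss the set \<open>V k\<close> that contains \<open>g\<close>.\<close>
  have "ball_le (s (Suc k)) (\<lambda>z. f (Suc k) z - g z) (e (Suc k))"
  proof (rule ball_leI)
    fix z :: "complex^'d" assume z: "norm z \<le> s (Suc k)"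
    show "norm (f (Suc k) z - g z) \<le> e (Suc k)"
    proof (rule Lim_bounded)
      show "(\<lambda>m. norm (f (Suc k) z - f m z)) \<longlonglongrightarrow> norm (f (Suc k) z - g z)"
        by (intro tendsto_intros g)
      show "\<forall>m\<ge>Suc k. norm (f (Suc k) z - f m z) \<le> e (Suc k)"
        using ball_leD[OF close z] by (simp add: norm_minus_commute)
    qed
  qed
  with Q(4)[OF k] show False by blast
qed

section \<open>Coefficients and partial sums with respect to a fixed basis\<close>

locale entire_basis =
  fixes \<phi> :: "nat \<Rightarrow> complex^'d \<Rightarrow> complex"
  assumes basis: "is_basis \<phi>"
begin

lemma entire_basis: "entire (\<phi> n)"
  using basis by (simp add: is_basis_def)

lemma coeffs_exist: "entire f \<Longrightarrow> \<exists>c. represents c \<phi> f"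
  using basis unfolding is_basis_def by blast

lemma coeffs_unique: "entire f \<Longrightarrow> represents c \<phi> f \<Longrightarrow> represents d \<phi> f \<Longrightarrow> c = d"
  using basis unfolding is_basis_def by blast

text \<open>Otherwise the coefficient of \<open>\<phi> n\<close> would be arbitrary in the expansion
  of the zero function, against uniqueness.\<close>

lemma basis_nonzero: "\<exists>z. \<phi> n z \<noteq> 0"
proof (rule ccontr)
  assume "\<not> ?thesis"
  then have "represents (\<lambda>k. if k = n then 1 else 0) \<phi> (\<lambda>z. 0)"
    using represents_finite[of "{n}" "\<lambda>k. if k = n then 1 else 0" \<phi>] by simp
  moreover have "represents (\<lambda>k. 0) \<phi> (\<lambda>z. 0)"
    using represents_finite[of "{}" "\<lambda>k. 0" \<phi>] by simp
  ultimately have "(\<lambda>k. if k = n then 1 else 0 :: complex) = (\<lambda>k. 0)"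
    by (rule coeffs_unique[OF entire_const])
  then show False by (metis zero_neq_one)
qed

lemma entire_partial_sum: "entire (\<lambda>z. \<Sum>n<N. c n * \<phi> n z)"
  by (intro entire_sum entire_cmult entire_basis)

text \<open>From some index on the partial sums are within 1 of \<open>f\<close>; the finitely many
  earlier ones are bounded separately. A natural number as bound provides the countable cover for
  the Baire argument.\<close>

lemma partial_sums_le_exists:
  assumes f: "entire f"
  obtains k :: nat where "partial_sums_le \<phi> r k f"
proof -
  obtain c where c: "represents c \<phi> f" using coeffs_exist[OF f] by blast
  obtain b where b: "b > 0" "ball_le r f b" using entire_bounded_on_ball[OF f] by blast
  obtain N0 where N0: "\<And>N. N \<ge> N0 \<Longrightarrow> ball_le r (\<lambda>z. (\<Sum>n<N. c n * \<phi> n z) - f z) 1"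
    using c unfolding represents_iff_ball by (meson zero_less_one)
  have "\<exists>\<beta>>0. ball_le r (\<lambda>z. \<Sum>n<N. c n * \<phi> n z) \<beta>" for N
    using entire_bounded_on_ball[OF entire_partial_sum] by blast
  then obtain \<beta> where \<beta>: "\<And>N. \<beta> N > 0" "\<And>N. ball_le r (\<lambda>z. \<Sum>n<N. c n * \<phi> n z) (\<beta> N)"
    by metis
  define a where "a = b + 1 + (\<Sum>N<N0. \<beta> N)"
  obtain k :: nat where k: "a \<le> k" using real_arch_simple by blast
  have s0: "(\<Sum>N<N0. \<beta> N) \<ge> 0" using \<beta>(1) by (intro sum_nonneg) (simp add: less_imp_le)
  have "ball_le r (\<lambda>z. \<Sum>n<N. c n * \<phi> n z) k" for N
  proof (cases "N \<ge> N0")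
    case True
    from ball_le_add[OF N0[OF True] b(2)] show ?thesis
      using s0 k by (auto simp: a_def intro: ball_le_mono)
  next
    case False
    then have "\<beta> N \<le> (\<Sum>N<N0. \<beta> N)"
      using \<beta>(1) by (intro member_le_sum) (auto simp: less_imp_le)
    then show ?thesis
      using \<beta>(2)[of N] k b(1) by (auto simp: a_def intro: ball_le_mono)
  qed
  with c have "partial_sums_le \<phi> r k f" unfolding partial_sums_le_def by blast
  then show ?thesis by (rule that)
qed

text \<open>The approximant g depends on the accuracy \<eta>, but the bound on its partial sums does not.\<close>
lemma partial_sums_le_dense:
  obtains s C where "C > 0"
    "\<And>f b t \<eta>. entire f \<Longrightarrow> b > 0 \<Longrightarrow> ball_le s f b \<Longrightarrow> \<eta> > 0 \<Longrightarrow>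
       \<exists>g. entire g \<and> partial_sums_le \<phi> r (C * b) g \<and> ball_le t (\<lambda>z. f z - g z) \<eta>"
proof -
  define V where "V k = {g. entire g \<and> partial_sums_le \<phi> r (real k) g}" for k :: nat
  have ex: "\<exists>k. f \<in> V k" if "entire f" for f
    using partial_sums_le_exists[OF that] that unfolding V_def by blast
  show ?thesis
  proof (rule Baire_entire[of V, OF ex])
    fix k f0 and s e :: real
    assume f0: "entire f0" "e > 0"
      "\<And>f t \<eta>. entire f \<Longrightarrow> ball_le s (\<lambda>z. f z - f0 z) e \<Longrightarrow> \<eta> > 0 \<Longrightarrow>
       \<exists>g\<in>V k. ball_le t (\<lambda>z. f z - g z) \<eta>"
    show ?thesis
  \<comment> \<open>A difference of two elements of \<open>V k\<close> has partial sums at most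
    \<open>2 * k\<close>, and rescaling from size \<open>e\<close> to size \<open>b\<close> gives
    the factor \<open>b / e\<close>. The 1 keeps the constant positive when
    \<open>k = 0\<close>.\<close>
  proof (rule that[of "(2 * k + 1) / e" s])
    show "(2 * k + 1) / e > 0" using f0 by simp
    fix f :: "complex^'d \<Rightarrow> complex" and b t \<eta> :: real
    assume f: "entire f" "b > 0" "ball_le s f b" "\<eta> > 0"
    define q where "q = e / b"
    have q: "q > 0" using f f0 by (simp add: q_def)
    define h where "h z = of_real q * f z" for z
    have "entire h"
      using entire_cmult[OF f(1)] by (simp add: h_def[abs_def])
    moreover have "ball_le s h e"
    proof -
      have "norm (of_real q :: complex) * b = e"
        using f0(2) f(2) by (simp only: norm_of_real) (simp add: q_def)
      then show ?thesis
        using ball_le_cmult[OF f(3), of "of_real q"] by (simp add: h_def[abs_def])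
    qed
    ultimately have h: "entire h" "ball_le s h e" by blast+
    \<comment> \<open>Two such errors are added and then divided by \<open>q\<close>, which leaves
      \<open>\<eta>\<close>.\<close>
    have eta: "q * \<eta> / 2 > 0" using q f by simp
    have 1: "entire (\<lambda>z. f0 z + h z)" "ball_le s (\<lambda>z. f0 z + h z - f0 z) e"
      using entire_add[OF f0(1) h(1)] h(2) by auto
    have 2: "ball_le s (\<lambda>z. f0 z - f0 z) e"
      using f0(2) by (simp add: ball_le_def)
    \<comment> \<open>Approximating both \<open>f0 + h\<close> and the centre \<open>f0\<close>
      moves the centre of the ball to 0.\<close>
    obtain g1 where g1: "g1 \<in> V k" "ball_le t (\<lambda>z. f0 z + h z - g1 z) (q * \<eta> / 2)"
      using f0(3)[OF 1 eta] by blast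
    obtain g2 where g2: "g2 \<in> V k" "ball_le t (\<lambda>z. f0 z - g2 z) (q * \<eta> / 2)"
      using f0(3)[OF f0(1) 2 eta] by blast
    define g where "g z = of_real (1/q) * (g1 z - g2 z)" for z
    have "entire g"
      using g1 g2 unfolding g_def V_def by (intro entire_cmult entire_diff) auto
    moreover have "partial_sums_le \<phi> r ((2 * k + 1) / e * b) g"
    proof -
      have "partial_sums_le \<phi> r (norm (of_real (1/q) :: complex) * (k + k)) g"
        unfolding g_def
      proof (rule partial_sums_le_cmult)
        have "partial_sums_le \<phi> r (real k + real k) (\<lambda>z. g1 z - g2 z)"
          by (rule partial_sums_le_diff) (use g1 g2 in \<open>auto simp: V_def\<close>)
        then show "partial_sums_le \<phi> r (real (k + k)) (\<lambda>z. g1 z - g2 z)" by simp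
      qed
      moreover have "norm (of_real (1/q) :: complex) * (k + k) \<le> (2 * k + 1) / e * b"
        using q f f0 by (simp only: norm_of_real) (simp add: q_def divide_right_mono mult_right_mono)
      ultimately show ?thesis by (auto intro: partial_sums_le_mono)
    qed
    moreover have "ball_le t (\<lambda>z. f z - g z) \<eta>"
    proof -
      have le: "ball_le t (\<lambda>z. of_real (1/q) * ((f0 z + h z - g1 z) - (f0 z - g2 z)))
          (norm (of_real (1/q) :: complex) * (q * \<eta> / 2 + q * \<eta> / 2))"
        by (intro ball_le_cmult ball_le_diff g1 g2)
      have eq: "of_real (1/q) * ((f0 z + h z - g1 z) - (f0 z - g2 z)) = f z - g z" for z
        using q by (simp add: g_def h_def field_simps)
      have norm: "norm (of_real (1/q) :: complex) * (q * \<eta> / 2 + q * \<eta> / 2) = \<eta>"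
        using q by (simp only: norm_of_real) simp
      show ?thesis using le unfolding eq norm .
    qed
    ultimately show "\<exists>g. entire g \<and> partial_sums_le \<phi> r ((2 * k + 1) / e * b) g \<and>
        ball_le t (\<lambda>z. f z - g z) \<eta>" by blast
  qed
  qed
qed

end

section \<open>Continuity of the partial sum operators\<close>

context entire_basis
begin

text \<open>Successive approximation: f is expanded as a series of functions G i whose partial sums are
at most \<gamma> i on the growing balls of radius r + i, so that the coefficients of the G i add up to
those of f.\<close>
lemma partial_sums_le_bound:
  obtains s C where "C > 0"
    "\<And>f b. entire f \<Longrightarrow> b > 0 \<Longrightarrow> ball_le s f b \<Longrightarrow> partial_sums_le \<phi> r (C * b) f"
proof -
  define P where "P i s C \<longleftrightarrow> C > 0 \<and>
     (\<forall>f b t \<eta>. entire f \<longrightarrow> b > 0 \<longrightarrow> ball_le s f b \<longrightarrow> \<eta> > 0 \<longrightarrow>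
       (\<exists>g. entire g \<and> partial_sums_le \<phi> (r + real i) (C * b) g \<and> ball_le t (\<lambda>z. f z - g z) \<eta>))"
    for i s C
  have "\<forall>i. \<exists>s C. P i s C"
  proof
    fix i
    show "\<exists>s C. P i s C"
    proof (rule partial_sums_le_dense[of "r + real i"])
      fix s C :: real
      assume "C > 0" "\<And>f b t \<eta>. entire f \<Longrightarrow> b > 0 \<Longrightarrow> ball_le s f b \<Longrightarrow> \<eta> > 0 \<Longrightarrow>
         \<exists>g. entire g \<and> partial_sums_le \<phi> (r + real i) (C * b) g \<and> ball_le t (\<lambda>z. f z - g z) \<eta>"
      then have "P i s C" unfolding P_def by blast
      then show ?thesis by blast
    qed
  qed
  then obtain \<sigma> C where P: "\<And>i. P i (\<sigma> i) (C i)" by metis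
  have C: "C i > 0" for i using P[of i] by (simp add: P_def)
  have dense: "\<exists>g. entire g \<and> partial_sums_le \<phi> (r + real i) (C i * b) g \<and> ball_le t (\<lambda>z. f z - g z) \<eta>"
    if "entire f" "b > 0" "ball_le (\<sigma> i) f b" "\<eta> > 0" for i f b t \<eta>
    using P[of i] that unfolding P_def by blast
  show ?thesis
  proof (rule that[of "C 0 + 1" "max (\<sigma> 0) 0"])
    show "C 0 + 1 > 0" using C[of 0] by simp
    fix f :: "complex^'d \<Rightarrow> complex" and b :: real
    assume f: "entire f" "b > 0" "ball_le (max (\<sigma> 0) 0) f b"
    \<comment> \<open>The remainder of stage \<open>i\<close> has to be small where
      \<open>dense\<close> asks for it and also on the ball of radius \<open>i\<close>, because
      \<open>\<sigma> i\<close> alone need not tend to infinity.\<close>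
    define s where "s i = max (\<sigma> i) (real i)" for i
    \<comment> \<open>For positive \<open>i\<close>, the denominator compensates the uncontrolled
      constant \<open>C i\<close>, so that the piece of stage \<open>i\<close> costs at most b /
      2^i. The total is C 0 b + b (1/2 + 1/4 + ...) = (C 0 + 1) b.\<close>
    define \<beta> where "\<beta> i = (if i = 0 then b else b * (1/2)^i / (C i + 1))" for i
    define \<gamma> where "\<gamma> i = (if i = 0 then C 0 * b else b * (1/2)^i)" for i
    have \<beta>: "\<beta> i > 0" for i using C[of i] f(2) by (simp add: \<beta>_def)
    have \<beta>_le: "\<beta> i \<le> b * (1/2)^i" for i
      using C[of i] f(2) by (simp add: \<beta>_def divide_le_eq mult_left_le)
    have C\<beta>: "C i * \<beta> i \<le> \<gamma> i" for i
      using C[of i] f(2) by (simp add: \<beta>_def \<gamma>_def divide_le_eq)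
    have \<gamma>0: "\<gamma> i > 0" for i using C[of 0] f(2) by (simp add: \<gamma>_def)
    have \<gamma>sums: "\<gamma> sums ((C 0 + 1) * b)"
    proof -
      have "(\<lambda>i. b * (1/2)^i) sums (b * (1 / (1 - 1/2)))"
        by (intro sums_mult geometric_sums) simp
      then have "(\<lambda>i. b * (1/2)^Suc i) sums (b * 2 - b)"
        by (subst sums_Suc_iff) (simp add: mult.commute)
      then have "(\<lambda>i. \<gamma> (Suc i)) sums (b * 2 - b)" by (simp add: \<gamma>_def)
      then show ?thesis
        by (subst (asm) sums_Suc_iff) (simp add: \<gamma>_def algebra_simps)
    qed
    have "\<exists>F. \<forall>i. (entire (F i) \<and> ball_le (s i) (F i) (\<beta> i) \<and> (i = 0 \<longrightarrow> F i = f)) \<and>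
        partial_sums_le \<phi> (r + i) (C i * \<beta> i) (\<lambda>z. F i z - F (Suc i) z)"
    proof (rule dependent_nat_choice)
      show "\<exists>F. entire F \<and> ball_le (s 0) F (\<beta> 0) \<and> (0 = (0::nat) \<longrightarrow> F = f)"
        using f by (auto simp: s_def \<beta>_def)
    next
      fix F and i :: nat
      assume F: "entire F \<and> ball_le (s i) F (\<beta> i) \<and> (i = 0 \<longrightarrow> F = f)"
      then have "ball_le (\<sigma> i) F (\<beta> i)" by (auto simp: s_def intro: ball_le_mono)
      then obtain g where g: "entire g" "partial_sums_le \<phi> (r + real i) (C i * \<beta> i) g"
        "ball_le (s (Suc i)) (\<lambda>z. F z - g z) (\<beta> (Suc i))"
        using dense[of F "\<beta> i" i "\<beta> (Suc i)" "s (Suc i)"] F \<beta> by blast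
      then show "\<exists>F'. (entire F' \<and> ball_le (s (Suc i)) F' (\<beta> (Suc i)) \<and> (Suc i = 0 \<longrightarrow> F' = f)) \<and>
          partial_sums_le \<phi> (r + i) (C i * \<beta> i) (\<lambda>z. F z - F' z)"
        using F by (intro exI[of _ "\<lambda>z. F z - g z"]) (simp add: entire_diff)
    qed
    then obtain F where F: "\<And>i. entire (F i)" "\<And>i. ball_le (s i) (F i) (\<beta> i)" "F 0 = f"
      "\<And>i. partial_sums_le \<phi> (r + i) (C i * \<beta> i) (\<lambda>z. F i z - F (Suc i) z)"
      by metis
    define G where "G i z = F i z - F (Suc i) z" for i z
    have "partial_sums_le \<phi> (r + i) (\<gamma> i) (G i)" for i
      using partial_sums_le_mono[OF F(4) order_refl C\<beta>] by (simp add: G_def[abs_def])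
    then have "\<forall>i. \<exists>c. represents c \<phi> (G i) \<and> (\<forall>N. ball_le (r + i) (\<lambda>z. \<Sum>n<N. c n * \<phi> n z) (\<gamma> i))"
      unfolding partial_sums_le_def by blast
    then obtain c where c: "\<And>i. represents (c i) \<phi> (G i)"
      "\<And>i N. ball_le (r + i) (\<lambda>z. \<Sum>n<N. c i n * \<phi> n z) (\<gamma> i)"
      by metis
    define S where "S i N z = (\<Sum>n<N. c i n * \<phi> n z)" for i N z
    have S: "norm (S i N z) \<le> \<gamma> i" if "norm z \<le> r + i" for i N z
      using ball_leD[OF c(2) that] by (simp add: S_def)
    have summ_c: "summable (\<lambda>i. c i n)" for n
    proof -
      obtain w where w: "\<phi> n w \<noteq> 0" using basis_nonzero by blast
      obtain I :: nat where I: "norm w - r \<le> I" using real_arch_simple by blast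
      \<comment> \<open>A term is the difference of two consecutive partial sums, and
        \<open>\<phi> n w\<close> can be divided out. From \<open>I\<close> on, \<open>w\<close>
        lies in the ball where \<open>\<gamma> i\<close> bounds these sums.\<close>
      have "norm (c i n) \<le> 2 * \<gamma> i / norm (\<phi> n w)" if "i \<ge> I" for i
      proof -
        have "norm w \<le> r + i" using that I by linarith
        then have "norm (S i (Suc n) w - S i n w) \<le> \<gamma> i + \<gamma> i"
          using S norm_triangle_ineq4 by (meson add_mono order_trans)
        then show ?thesis using w by (simp add: S_def norm_mult le_divide_eq)
      qed
      then have "\<forall>\<^sub>F i in sequentially. norm (c i n) \<le> 2 * \<gamma> i / norm (\<phi> n w)"
        unfolding eventually_sequentially by blast
      then show ?thesis
        by (rule summable_comparison_test_ev)
          (use \<gamma>sums in \<open>auto intro!: summable_divide summable_mult simp: sums_iff\<close>)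
    qed
    define a where "a n = (\<Sum>i. c i n)" for n
    have T: "(\<lambda>i. S i N z) sums (\<Sum>n<N. a n * \<phi> n z)" for N z
      unfolding S_def a_def
      by (intro sums_sum sums_mult2 summable_sums summ_c)
    \<comment> \<open>This holds uniformly in \<open>N\<close>, which permits truncating the sum
      over \<open>i\<close> before letting \<open>N\<close> tend to infinity.\<close>
    have tail: "norm ((\<Sum>n<N. a n * \<phi> n z) - (\<Sum>i<I. S i N z)) \<le> (\<Sum>i. \<gamma> (i + I))"
      if z: "norm z \<le> r + I" for I N z
    proof -
      have "(\<lambda>i. S (i + I) N z) sums ((\<Sum>n<N. a n * \<phi> n z) - (\<Sum>i<I. S i N z))"
        by (rule sums_split_initial_segment[OF T])
      moreover have "norm (\<Sum>i. S (i + I) N z) \<le> (\<Sum>i. \<gamma> (i + I))"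
      proof (rule norm_suminf_le)
        show "norm (S (i + I) N z) \<le> \<gamma> (i + I)" for i
          using z by (intro S) simp
        show "summable (\<lambda>i. \<gamma> (i + I))"
          using \<gamma>sums by (simp add: sums_iff)
      qed
      ultimately show ?thesis by (simp add: sums_iff)
    qed
    have "ball_le r (\<lambda>z. \<Sum>n<N. a n * \<phi> n z) ((C 0 + 1) * b)" for N
      using tail[of _ 0 N] \<gamma>sums by (auto simp: ball_le_def sums_iff)
    moreover have "represents a \<phi> f"
      unfolding represents_iff_ball
    proof (intro allI impI)
      fix t e :: real assume "e > 0"
      then have e: "e / 3 > 0" by simp
      obtain I1 where I1: "\<And>I. I \<ge> I1 \<Longrightarrow> norm (\<Sum>i. \<gamma> (i + I)) < e/3"
        using suminf_exist_split[OF e, of \<gamma>] \<gamma>sums by (auto simp: sums_iff)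
      obtain I2 where I2: "(1/2)^I2 < e / 3 / b"
        using real_arch_pow_inv[of "e/3/b" "1/2"] e f(2) by auto
      obtain I3 :: nat where I3: "max t (t - r) \<le> I3" using real_arch_simple by blast
      \<comment> \<open>\<open>I1\<close> makes the tail of \<open>\<gamma>\<close> small,
        \<open>I2\<close> makes the remainder \<open>F I\<close> small, and \<open>I3\<close> makes
        both estimates available on the ball of radius \<open>t\<close>.\<close>
      define I where "I = max I1 (max I2 I3)"
      have tail_I: "norm (\<Sum>i. \<gamma> (i + I)) < e/3" by (rule I1) (simp add: I_def)
      have "(1/2)^I \<le> (1/2::real)^I2" by (rule power_decreasing) (auto simp: I_def)
      then have "(1/2)^I < e / 3 / b" using I2 by linarith
      then have "b * (1/2)^I < e/3" using f(2) by (simp add: pos_less_divide_eq mult.commute)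
      then have \<beta>I: "\<beta> I \<le> e/3" using \<beta>_le[of I] by linarith
      have tI: "t \<le> s I" "t \<le> r + I" using I3 by (auto simp: I_def s_def)
      have tele: "(\<Sum>i<I. G i z) = f z - F I z" for z
        unfolding G_def by (induction I) (auto simp: F(3))
      have "represents (\<lambda>n. \<Sum>i<I. c i n) \<phi> (\<lambda>z. \<Sum>i<I. G i z)"
        by (intro represents_sum c)
      then obtain N0 where N0: "\<And>N. N \<ge> N0 \<Longrightarrow>
          ball_le t (\<lambda>z. (\<Sum>n<N. (\<Sum>i<I. c i n) * \<phi> n z) - (\<Sum>i<I. G i z)) (e/3)"
        using e unfolding represents_iff_ball by meson
      show "\<exists>N0. \<forall>N\<ge>N0. ball_le t (\<lambda>z. (\<Sum>n<N. a n * \<phi> n z) - f z) e"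
      proof (intro exI[of _ N0] allI impI ball_leI)
        fix N and z :: "complex^'d" assume N: "N \<ge> N0" and z: "norm z \<le> t"
        have swap: "(\<Sum>n<N. (\<Sum>i<I. c i n) * \<phi> n z) = (\<Sum>i<I. S i N z)"
          unfolding S_def sum_distrib_right by (rule sum.swap)
        have 1: "norm ((\<Sum>i<I. S i N z) - (\<Sum>i<I. G i z)) \<le> e/3"
          using ball_leD[OF N0[OF N] z] by (simp add: swap)
        have 2: "norm ((\<Sum>n<N. a n * \<phi> n z) - (\<Sum>i<I. S i N z)) \<le> e/3"
          using tail[of z I N] z tI tail_I by simp
        have 3: "norm (F I z) \<le> e/3"
          using ball_leD[OF F(2), of z I] z tI \<beta>I by simp
        have eq: "(\<Sum>n<N. a n * \<phi> n z) - f z =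
          ((\<Sum>n<N. a n * \<phi> n z) - (\<Sum>i<I. S i N z)) + ((\<Sum>i<I. S i N z) - (\<Sum>i<I. G i z)) - F I z"
          by (simp add: tele)
        show "norm ((\<Sum>n<N. a n * \<phi> n z) - f z) \<le> e"
          unfolding eq
          by (rule order_trans[OF norm_triangle_ineq4])
            (use 1 2 3 norm_triangle_ineq[of "(\<Sum>n<N. a n * \<phi> n z) - (\<Sum>i<I. S i N z)"
              "(\<Sum>i<I. S i N z) - (\<Sum>i<I. G i z)"] in linarith)
      qed
    qed
    ultimately show "partial_sums_le \<phi> r ((C 0 + 1) * b) f"
      unfolding partial_sums_le_def by blast
  qed
qed

text \<open>A term is the difference of two consecutive partial sums, whence a factor 2. Uniqueness
  identifies the coefficients supplied by \<open>partial_sums_le_bound\<close> with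
  \<open>c\<close>.\<close>

lemma coeff_estimate:
  obtains s C where "C > 0"
    "\<And>f c b n. entire f \<Longrightarrow> represents c \<phi> f \<Longrightarrow> b > 0 \<Longrightarrow> ball_le s f b \<Longrightarrow>
       ball_le r (\<lambda>z. c n * \<phi> n z) (C * b)"
proof (rule partial_sums_le_bound[of r])
  fix s C :: real
  assume C: "C > 0"
    "\<And>f b. entire f \<Longrightarrow> b > 0 \<Longrightarrow> ball_le s f b \<Longrightarrow> partial_sums_le \<phi> r (C * b) f"
  show thesis
  proof (rule that[of "2 * C" s])
    show "2 * C > 0" using C by simp
    fix f :: "complex^'d \<Rightarrow> complex" and c and b :: real and n
    assume f: "entire f" "represents c \<phi> f" "b > 0" "ball_le s f b"
    obtain d where "represents d \<phi> f" and d: "\<And>N. ball_le r (\<lambda>z. \<Sum>n<N. d n * \<phi> n z) (C * b)"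
      using C(2)[OF f(1,3,4)] unfolding partial_sums_le_def by blast
    with f have "d = c" using coeffs_unique by blast
    with ball_le_diff[OF d[of "Suc n"] d[of n]]
    show "ball_le r (\<lambda>z. c n * \<phi> n z) (2 * C * b)" by (simp add: mult.assoc)
  qed
qed

end

section \<open>Nuclearity: functions vanishing on a grid\<close>

text \<open>Gaussian elimination: an equation with a nonzero entry \<open>a y k\<close> is solved
  for the unknown \<open>k\<close>, and substitution leaves one equation and one unknown
  fewer.\<close>

lemma underdetermined_system:
  fixes a :: "'z \<Rightarrow> 'j \<Rightarrow> 'a :: field"
  assumes "finite Z" "finite F" "card Z < card F"
  shows "\<exists>x. (\<exists>j\<in>F. x j \<noteq> 0) \<and> (\<forall>z\<in>Z. (\<Sum>j\<in>F. x j * a z j) = 0)"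
  using assms
proof (induction Z arbitrary: F a rule: finite_induct)
  case empty
  then have "F \<noteq> {}" by auto
  then show ?case by (intro exI[of _ "\<lambda>_. 1"]) auto
next
  case (insert y Z)
  show ?case
  proof (cases "\<forall>j\<in>F. a y j = 0")
    case True
    then have "(\<Sum>j\<in>F. x j * a y j) = 0" for x by simp
    with insert.IH[of F a] insert.prems insert.hyps show ?thesis by auto
  next
    case False
    then obtain k where k: "k \<in> F" "a y k \<noteq> 0" by blast
    have "card Z < card (F - {k})" using insert.prems insert.hyps k by simp
    with insert.IH[of "F - {k}" "\<lambda>z j. a z j - a z k * a y j / a y k"] insert.prems
    obtain x where x: "\<exists>j\<in>F - {k}. x j \<noteq> 0"
      "\<forall>z\<in>Z. (\<Sum>j\<in>F - {k}. x j * (a z j - a z k * a y j / a y k)) = 0" by auto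
    define \<xi> where "\<xi> = - (\<Sum>j\<in>F - {k}. x j * a y j) / a y k"
    define x' where "x' = x(k := \<xi>)"
    have sum: "(\<Sum>j\<in>F. x' j * a z j) = \<xi> * a z k + (\<Sum>j\<in>F - {k}. x j * a z j)" for z
      using insert.prems k by (subst sum.remove[of _ k]) (auto simp: x'_def intro!: sum.cong)
    have "(\<Sum>j\<in>F. x' j * a y j) = 0" using k by (simp add: sum \<xi>_def)
    moreover have "(\<Sum>j\<in>F. x' j * a z j) = 0" if "z \<in> Z" for z
    proof -
      have "\<xi> * a z k = - (\<Sum>j\<in>F - {k}. x j * (a z k * a y j / a y k))"
        using k by (simp add: \<xi>_def sum_distrib_left sum_divide_distrib sum_negf[symmetric] mult_ac)
      then show ?thesis
        using x(2) that by (simp add: sum right_diff_distrib sum_subtractf)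
    qed
    moreover have "\<exists>j\<in>F. x' j \<noteq> 0" using x(1) by (auto simp: x'_def)
    ultimately show ?thesis by (intro exI[of _ x']) auto
  qed
qed

text \<open>The lattice of mesh 1/m in a cube: rounding down real coordinates of absolute value at
  most \<open>L\<close> does not leave it.\<close>

definition grid :: "nat \<Rightarrow> nat \<Rightarrow> (complex^'d) set" where
  "grid m L = {w. \<forall>i. \<exists>(a::int) (b::int). \<bar>a\<bar> \<le> int (m * L) \<and> \<bar>b\<bar> \<le> int (m * L) \<and> w $ i = Complex (a / m) (b / m)}"

text \<open>A point is determined by two integers for each coordinate, each with
  \<open>2 * m * L + 1\<close> possible values.\<close>

lemma card_grid: "finite (grid m L :: (complex^'d) set)"
    "card (grid m L :: (complex^'d) set) \<le> (2 * m * L + 1) ^ (2 * CARD('d))"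
proof -
  define I where "I = {- int (m * L)..int (m * L)}"
  define V :: "('d \<Rightarrow> int \<times> int) set" where "V = (\<Pi>\<^sub>E i\<in>UNIV. I \<times> I)"
  define h :: "('d \<Rightarrow> int \<times> int) \<Rightarrow> complex^'d" where
    "h u = (\<chi> i. Complex (fst (u i) / m) (snd (u i) / m))" for u
  have sub: "grid m L \<subseteq> h ` V"
  proof
    fix w :: "complex^'d" assume "w \<in> grid m L"
    then obtain a b :: "'d \<Rightarrow> int" where ab: "\<And>i. \<bar>a i\<bar> \<le> int (m * L)" "\<And>i. \<bar>b i\<bar> \<le> int (m * L)"
      "\<And>i. w $ i = Complex (a i / m) (b i / m)"
      unfolding grid_def mem_Collect_eq by metis
    have "w = h (\<lambda>i. (a i, b i))" by (simp add: h_def vec_eq_iff ab)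
    moreover have "(\<lambda>i. (a i, b i)) \<in> V"
      using ab(1,2) by (auto simp: V_def I_def PiE_def Pi_def abs_le_iff minus_le_iff)
    ultimately show "w \<in> h ` V" by blast
  qed
  have fin: "finite V" by (auto simp: V_def I_def intro!: finite_PiE)
  then show "finite (grid m L :: (complex^'d) set)" using sub finite_subset by blast
  have "card (grid m L :: (complex^'d) set) \<le> card V"
    using sub fin by (rule surj_card_le[rotated])
  also have "card I = 2 * m * L + 1" by (simp add: I_def nat_eq_iff mult_ac)
  then have "card V = (2 * m * L + 1) ^ (2 * CARD('d))"
    by (simp add: V_def card_PiE card_cartesian_product power_mult power2_eq_square)
  finally show "card (grid m L :: (complex^'d) set) \<le> (2 * m * L + 1) ^ (2 * CARD('d))" .
qed

text \<open>Rounding down changes each of the \<open>2 * CARD('d)\<close> real coordinates by at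
  most 1/m, and the norm is at most the sum of these changes.\<close>

lemma grid_dense:
  fixes z :: "complex^'d"
  assumes z: "norm z \<le> L" and m: "m > 0"
  obtains w where "w \<in> grid m L" "norm (z - w) \<le> 2 * CARD('d) / m"
proof -
  define w :: "complex^'d" where
    "w = (\<chi> i. Complex (\<lfloor>m * Re (z $ i)\<rfloor> / m) (\<lfloor>m * Im (z $ i)\<rfloor> / m))"
  have fl: "\<bar>\<lfloor>m * x\<rfloor>\<bar> \<le> int (m * L)" if "\<bar>x\<bar> \<le> L" for x :: real
  proof -
    have "\<bar>m * x\<bar> \<le> real m * real L" using that by (simp add: abs_mult mult_left_mono)
    then have "m * x \<le> of_int (int (m * L))" "of_int (- int (m * L)) \<le> m * x" by auto
    then show ?thesis by linarith
  qed
  have err: "\<bar>x - \<lfloor>m * x\<rfloor> / m\<bar> \<le> 1 / m" for x :: real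
  proof -
    have "\<bar>m * x - \<lfloor>m * x\<rfloor>\<bar> \<le> 1" by linarith
    then have "\<bar>m * x - \<lfloor>m * x\<rfloor>\<bar> / m \<le> 1 / m" by (rule divide_right_mono) simp
    also have "\<bar>m * x - \<lfloor>m * x\<rfloor>\<bar> / m = \<bar>(m * x - \<lfloor>m * x\<rfloor>) / m\<bar>" by simp
    also have "(m * x - \<lfloor>m * x\<rfloor>) / m = x - \<lfloor>m * x\<rfloor> / m"
      using m by (simp add: diff_divide_distrib)
    finally show ?thesis .
  qed
  have zi: "\<bar>Re (z $ i)\<bar> \<le> L" "\<bar>Im (z $ i)\<bar> \<le> L" for i
    using z Finite_Cartesian_Product.norm_nth_le[of z i] abs_Re_le_cmod[of "z $ i"] abs_Im_le_cmod[of "z $ i"] by linarith+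
  have "w \<in> grid m L"
    using fl[OF zi(1)] fl[OF zi(2)] unfolding grid_def w_def by auto
  moreover have "norm (z - w) \<le> 2 * CARD('d) / m"
  proof -
    have "norm (z - w) \<le> (\<Sum>i\<in>UNIV. norm ((z - w) $ i))"
      unfolding norm_vec_def by (rule L2_set_le_sum) simp
    also have "\<dots> \<le> (\<Sum>i\<in>(UNIV::'d set). 2 / m)"
    proof (rule sum_mono)
      fix i
      have "norm ((z - w) $ i) \<le> \<bar>Re ((z - w) $ i)\<bar> + \<bar>Im ((z - w) $ i)\<bar>" by (rule cmod_le)
      also have "\<dots> \<le> 1 / m + 1 / m"
        using err[of "Re (z $ i)"] err[of "Im (z $ i)"] by (intro add_mono) (simp_all add: w_def)
      finally show "norm ((z - w) $ i) \<le> 2 / m" by simp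
    qed
    finally show ?thesis by (simp add: mult.commute)
  qed
  ultimately show ?thesis by (rule that)
qed

text \<open>Compare \<open>g z\<close> with the value 0 at a nearby grid point. One unit of radius
  lets that point lie outside the ball of radius \<open>s\<close>, the other goes into the Lipschitz
  estimate. If the factor exceeds 1, the bound \<open>b\<close> already suffices.\<close>

lemma vanishing_on_grid_shrink:
  fixes g :: "complex^'d \<Rightarrow> complex"
  assumes g: "entire g" "\<And>w. w \<in> grid m L \<Longrightarrow> g w = 0" and m: "m > 0"
    and b: "ball_le (s + 2) g b" "b \<ge> 0" and s: "s \<le> L"
  shows "ball_le s g (2 * CARD('d) / m * b)"
proof (rule ball_leI)
  fix z :: "complex^'d" assume z: "norm z \<le> s"
  let ?q = "2 * CARD('d) / real m"
  show "norm (g z) \<le> ?q * b"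
  proof (cases "?q \<le> 1")
    case True
    obtain w where w: "w \<in> grid m L" "norm (z - w) \<le> ?q"
      using grid_dense[of z L m] z s m by auto
    have "norm w \<le> s + 1"
      using norm_triangle_ineq3[of z w] w True z by linarith
    then have "norm (g z - g w) \<le> b * norm (z - w)"
      using z b by (intro entire_Lipschitz_on_ball[OF g(1), of "s + 1"]) (simp_all add: add.assoc)
    also have "\<dots> \<le> b * ?q" using w b by (intro mult_left_mono) auto
    finally show ?thesis using g(2)[OF w(1)] by (simp add: mult.commute)
  next
    case False
    have "norm (g z) \<le> 1 * b" using ball_leD[OF b(1), of z] z by simp
    also have "\<dots> \<le> ?q * b" using False b by (intro mult_right_mono) auto
    finally show ?thesis .
  qed
qed

text \<open>Each of \<open>p\<close> shrinking steps costs 2 in the radius and gains one factor; the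
  same grid serves all of them.\<close>

lemma vanishing_on_grid_small:
  fixes g :: "complex^'d \<Rightarrow> complex"
  assumes g: "entire g" "\<And>w. w \<in> grid m L \<Longrightarrow> g w = 0" and m: "m > 0"
    and "ball_le (s + 2 * real p) g b" "b \<ge> 0" "s + 2 * real p \<le> L"
  shows "ball_le s g ((2 * CARD('d) / m) ^ p * b)"
  using assms(4-6)
proof (induction p arbitrary: b)
  case (Suc p)
  have "2 * real p \<le> 2 * real (Suc p)" by simp
  then have sL: "s + 2 * real p \<le> L" by (rule order_trans[OF add_left_mono Suc.prems(3)])
  have "ball_le (s + 2 * real p) g (2 * CARD('d) / m * b)"
    by (rule vanishing_on_grid_shrink[OF g m]) (use Suc.prems(1,2) sL in \<open>simp_all add: algebra_simps\<close>)
  from Suc.IH[OF this _ sL] Suc.prems(2)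
  have "ball_le s g ((2 * CARD('d) / m) ^ p * (2 * CARD('d) / m * b))" by simp
  then show ?case by (simp only: power_Suc mult_ac)
qed simp

text \<open>To be applied to the quotients |\<phi>_n|_r / |\<phi>_n|_R. The exponent of the
  threshold exceeds that of the count by 2, which leaves a sum of inverse squares.\<close>

lemma summable_of_counting_bound:
  fixes w :: "nat \<Rightarrow> real"
  assumes w: "\<And>n. 0 \<le> w n" "\<And>n. w n \<le> W" and D: "D > 0"
    and count: "\<And>m F. m > 0 \<Longrightarrow> finite F \<Longrightarrow> (\<And>n. n \<in> F \<Longrightarrow> w n > D / real m ^ (t + 2)) \<Longrightarrow>
        card F \<le> E * m ^ t"
  shows "summable w"
proof -
  define h where "h j = D / real (Suc j) ^ (t + 2)" for j
  text \<open>There are at most E (j+1)^t indices in the shell \<mu> n = j, and w n is O(j^(-t-2)) on it.\<close>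
  define \<mu> where "\<mu> n = (LEAST j. h j < w n)" for n
  \<comment> \<open>Shell 0 has no threshold above it, so only \<open>W\<close> bounds its terms.
    The factor \<open>2 ^ t\<close> comes from \<open>Suc j \<le> 2 * j\<close> for positive
    \<open>j\<close>.\<close>
  define \<beta> where "\<beta> j = (case j of 0 \<Rightarrow> W * E | Suc i \<Rightarrow> D * E * 2 ^ t * inverse (real (Suc i) ^ 2))" for j
  have W: "W \<ge> 0" using w order_trans by blast
  have "summable (\<lambda>i. inverse (real (Suc i) ^ 2))"
    using inverse_power_summable[of 2, where 'a = real] by (subst summable_Suc_iff) simp
  then have "summable (\<lambda>i. \<beta> (Suc i))" by (simp add: \<beta>_def summable_mult)
  then have \<beta>sum: "summable \<beta>" by (simp add: summable_Suc_iff)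
  have \<beta>0: "\<beta> j \<ge> 0" for j using W D by (simp add: \<beta>_def split: nat.split)
  have ex: "\<exists>j. h j < w n" if "w n > 0" for n
  proof -
    obtain j :: nat where j: "D / w n < j" using reals_Archimedean2 by blast
    have "real (Suc j) ^ 1 \<le> real (Suc j) ^ (t + 2)" by (rule power_increasing) auto
    with j have "D / w n < real (Suc j) ^ (t + 2)"
      by (simp only: power_one_right of_nat_Suc)
    then have "h j < w n" using that by (simp add: h_def divide_less_eq mult.commute del: of_nat_Suc)
    then show ?thesis by blast
  qed
  have shell: "(\<Sum>n\<in>F. w n) \<le> \<beta> j" if F: "finite F" "\<And>n. n \<in> F \<Longrightarrow> w n > 0 \<and> \<mu> n = j" for F j
  proof -
    have gt: "w n > h j" if "n \<in> F" for n
      using F(2)[OF that] ex LeastI_ex[of "\<lambda>j. h j < w n"] by (auto simp: \<mu>_def)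
    then have c: "card F \<le> E * Suc j ^ t"
      by (intro count) (use F in \<open>auto simp: h_def\<close>)
    show ?thesis
    proof (cases j)
      case 0
      have "(\<Sum>n\<in>F. w n) \<le> of_nat (card F) * W" using w by (intro sum_bounded_above)
      also have "\<dots> \<le> real E * W" using c 0 W by (intro mult_right_mono) auto
      finally show ?thesis by (simp add: \<beta>_def 0 mult.commute)
    next
      case (Suc i)
      have "w n \<le> h i" if "n \<in> F" for n
        using F(2)[OF that] not_less_Least[of i "\<lambda>j. h j < w n"] Suc by (auto simp: \<mu>_def)
      then have "(\<Sum>n\<in>F. w n) \<le> of_nat (card F) * h i" by (intro sum_bounded_above)
      also have "\<dots> \<le> real (E * Suc j ^ t) * h i"
        using c D by (intro mult_right_mono) (simp_all only: of_nat_le_iff, simp add: h_def)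
      also have "real (E * Suc j ^ t) \<le> real (E * (2 * Suc i) ^ t)"
        unfolding of_nat_le_iff using Suc by (intro mult_left_mono power_mono) auto
      then have "real (E * Suc j ^ t) * h i \<le> real (E * (2 * Suc i) ^ t) * h i"
        using D by (intro mult_right_mono) (simp_all add: h_def)
      also have "\<dots> = D * E * 2 ^ t * inverse (real (Suc i) ^ 2)"
        unfolding h_def of_nat_mult of_nat_power power_mult_distrib power_add
        by (simp add: field_simps del: of_nat_Suc)
      finally show ?thesis by (simp add: \<beta>_def Suc)
    qed
  qed
  show ?thesis
  proof (rule summableI_nonneg_bounded[OF w(1)])
    fix n
    \<comment> \<open>Zero terms exceed no threshold, so \<open>\<mu>\<close> carries no information
      about them.\<close>
    define F where "F = {k. k < n \<and> w k > 0}"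
    have fin: "finite F" by (simp add: F_def)
    have "(\<Sum>k<n. w k) = (\<Sum>k\<in>F. w k)"
      using w(1) by (intro sum.mono_neutral_right) (auto simp: F_def less_le)
    also have "\<dots> = (\<Sum>j\<in>\<mu> ` F. \<Sum>k | k \<in> F \<and> \<mu> k = j. w k)"
      by (rule sum.image_gen[OF fin])
    also have "\<dots> \<le> (\<Sum>j\<in>\<mu> ` F. \<beta> j)"
      by (intro sum_mono shell) (use fin in \<open>auto simp: F_def\<close>)
    also have "\<dots> \<le> suminf \<beta>"
      using \<beta>0 \<beta>sum fin by (intro sum_le_suminf) auto
    finally show "(\<Sum>k<n. w k) \<le> suminf \<beta>" .
  qed
qed

section \<open>Absoluteness of bases and the Bohr property\<close>

context entire_basis
begin

text \<open>With too many indices there are more functions than grid points, so some combination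
  vanishes on the grid and is tiny on the ball of \<open>coeff_estimate\<close>. That estimate, for
  the index of the largest normalized coefficient, contradicts the lower bound assumed for this
  index.\<close>

lemma basis_counting:
  fixes r :: real
  assumes r: "r \<ge> 0"
  obtains R D E t where "R \<ge> r" "D > 0"
    "\<And>m F. m > 0 \<Longrightarrow> finite F \<Longrightarrow>
      (\<And>n. n \<in> F \<Longrightarrow> supnorm (cball 0 r) (\<phi> n) > D / real m ^ (t + 2) * supnorm (cball 0 R) (\<phi> n)) \<Longrightarrow>
      card F \<le> E * m ^ t"
proof (rule coeff_estimate[of r])
  fix s C :: real
  assume C: "C > 0"
    "\<And>f c b n. entire f \<Longrightarrow> represents c \<phi> f \<Longrightarrow> b > 0 \<Longrightarrow> ball_le s f b \<Longrightarrow>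
       ball_le r (\<lambda>z. c n * \<phi> n z) (C * b)"
  \<comment> \<open>The real dimension is both the exponent of \<open>m\<close> in the size of the
    grid and the numerator of the gain in each shrinking step.\<close>
  define t where "t = 2 * CARD('d)"
  \<comment> \<open>Of these powers of 1/m, \<open>t\<close> pay for the number of functions and the
    other \<open>t + 2\<close> form the threshold.\<close>
  define p where "p = 2 * t + 2"
  have p_eq: "p = t + (t + 2)" by (simp add: p_def)
  define s0 where "s0 = nat \<lceil>max s r\<rceil>"
  have "max s r \<le> s0" unfolding s0_def by (rule real_nat_ceiling_ge)
  then have s0: "s \<le> s0" "r \<le> s0" by simp_all
  \<comment> \<open>This leaves room for \<open>p\<close> shrinking steps of length 2 above
    \<open>s0\<close>.\<close>
  define L where "L = s0 + 2 * p"
  define E where "E = (2 * L + 1) ^ t"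
  define D where "D = C * real t ^ p * real (E + 1)"
  have "t > 0" by (simp add: t_def)
  then have D: "D > 0" using C by (simp add: D_def)
  show thesis
  proof (rule that[of L D t E])
    show "real L \<ge> r" using s0 by (simp add: L_def)
    show "D > 0" by (rule D)
    fix m :: nat and F :: "nat set"
    assume m: "m > 0" and "finite F" and
      F: "\<And>n. n \<in> F \<Longrightarrow> supnorm (cball 0 r) (\<phi> n) > D / real m ^ (t + 2) * supnorm (cball 0 (real L)) (\<phi> n)"
    define A B where "A n = supnorm (cball 0 r) (\<phi> n)" and "B n = supnorm (cball 0 (real L)) (\<phi> n)" for n
    show "card F \<le> E * m ^ t"
    proof (rule ccontr)
      assume "\<not> ?thesis"
      then have "Suc (E * m ^ t) \<le> card F" by simp
      then obtain F' where F': "F' \<subseteq> F" "card F' = Suc (E * m ^ t)" "finite F'"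
        by (rule obtain_subset_with_card_n)
      have "2 * m * L + 1 \<le> (2 * L + 1) * m" using m by (simp add: algebra_simps)
      then have "(2 * m * L + 1) ^ t \<le> E * m ^ t"
        unfolding E_def power_mult_distrib[symmetric] by (rule power_mono) simp
      then have "card (grid m L :: (complex^'d) set) < card F'"
        using card_grid(2)[of m L, where 'd = 'd] F' by (simp add: t_def)
      \<comment> \<open>Division by \<open>B j\<close> normalizes the functions on the large ball,
        so that the coefficients \<open>x j\<close> alone measure the combination there.\<close>
      from underdetermined_system[OF card_grid(1) F'(3) this, of "\<lambda>z j. \<phi> j z / of_real (B j)"]
      obtain x where x: "\<exists>j\<in>F'. x j \<noteq> 0"
        "\<And>z. z \<in> grid m L \<Longrightarrow> (\<Sum>j\<in>F'. x j * (\<phi> j z / of_real (B j))) = 0" by blast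
      define X where "X = Max ((\<lambda>j. norm (x j)) ` F')"
      have X_ge: "norm (x j) \<le> X" if "j \<in> F'" for j
        unfolding X_def using F'(3) that by (intro Max_ge) auto
      have "X \<in> (\<lambda>j. norm (x j)) ` F'"
        unfolding X_def using F' x(1) by (intro Max_in) auto
      then obtain i where i: "i \<in> F'" "norm (x i) = X" by auto
      have X: "X > 0" using x(1) X_ge by (meson order_less_le_trans zero_less_norm_iff)
      define c where "c n = (if n \<in> F' then x n / of_real (B n) else 0)" for n
      define g where "g z = (\<Sum>j\<in>F'. c j * \<phi> j z)" for z
      have "entire g"
        unfolding g_def by (intro entire_sum entire_cmult entire_basis)
      moreover have "represents c \<phi> g"
        unfolding g_def by (rule represents_finite[OF F'(3)]) (simp add: c_def)
      ultimately have g: "entire g" "represents c \<phi> g" .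
      have g0: "g z = 0" if "z \<in> grid m L" for z
        using x(2)[OF that] by (simp add: g_def c_def)
      have B0: "B n \<ge> 0" for n unfolding B_def by (intro supnorm_nonneg entire_basis) simp
      define N where "N = real (card F')"
      have N: "N > 0" unfolding N_def of_nat_0_less_iff F'(2) by simp
      have "ball_le (s0 + 2 * real p) g (N * X)"
      proof (rule ball_leI)
        fix z :: "complex^'d" assume "norm z \<le> s0 + 2 * real p"
        then have z: "norm z \<le> L" by (simp add: L_def)
        have "norm (c j * \<phi> j z) \<le> X" if "j \<in> F'" for j
        proof (cases "B j = 0")
          case True
          then show ?thesis using X by (simp add: c_def)
        next
          case False
          have "norm (\<phi> j z) \<le> B j"
            unfolding B_def by (rule ball_leD[OF ball_le_supnorm z]) (auto intro: entire_basis)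
          then have "norm (x j) * norm (\<phi> j z) \<le> X * B j"
            using X_ge[OF that] by (intro mult_mono) (use X in auto)
          then show ?thesis using False B0[of j] that
            by (simp add: c_def norm_mult norm_divide divide_le_eq)
        qed
        then have "norm (g z) \<le> (\<Sum>j\<in>F'. X)"
          unfolding g_def by (rule sum_norm_le)
        then show "norm (g z) \<le> N * X" by (simp add: N_def)
      qed
      then have "ball_le s0 g ((2 * CARD('d) / m) ^ p * (N * X))"
        using vanishing_on_grid_small[OF g(1) g0 m, where s = "real s0" and p = p and b = "N * X"] N X
        by (simp add: L_def)
      then have gs: "ball_le s g ((t / m) ^ p * (N * X))"
        using s0 by (auto simp: t_def intro: ball_le_mono)
      have pos: "(t / m) ^ p * (N * X) > 0" using m N X \<open>t > 0\<close> by simp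
      \<comment> \<open>As \<open>i\<close> is the index of the largest \<open>x j\<close>, the
        factor \<open>X\<close> will cancel from both sides.\<close>
      have ci: "ball_le r (\<lambda>z. c i * \<phi> i z) (C * ((t / m) ^ p * (N * X)))"
        by (rule C(2)[OF g pos gs])
      have "A i > D / real m ^ (t + 2) * B i" using F i F' by (auto simp: A_def B_def)
      moreover have "D / real m ^ (t + 2) * B i \<ge> 0" using D B0[of i] by simp
      ultimately have Ai: "A i > 0" by linarith
      have "A i \<le> B i"
        unfolding A_def using s0 B0[of i]
        by (intro supnorm_le[where r = L]) (auto simp: B_def L_def intro!: ball_le_supnorm entire_basis)
      with Ai have Bi: "B i > 0" by simp
      have "A i \<le> C * (t / m) ^ p * N * B i"
        unfolding A_def
      proof (rule supnorm_le[OF _ order_refl])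
        show "ball_le r (\<phi> i) (C * (t / m) ^ p * N * B i)"
        proof (rule ball_leI)
          fix z :: "complex^'d" assume "norm z \<le> r"
          from ball_leD[OF ci this] have "X / B i * norm (\<phi> i z) \<le> X * (C * ((t / m) ^ p * N))"
            using i Bi by (simp add: c_def norm_mult norm_divide mult_ac)
          then have "X * norm (\<phi> i z) \<le> X * (C * (t / m) ^ p * N * B i)"
            using Bi by (simp add: pos_divide_le_eq mult_ac)
          then show "norm (\<phi> i z) \<le> C * (t / m) ^ p * N * B i" using X by simp
        qed
        show "C * (t / m) ^ p * N * B i \<ge> 0" using C Bi N by simp
      qed
      moreover have "C * (t / m) ^ p * N \<le> D / real m ^ (t + 2)"
      proof -
        have "m ^ t \<ge> 1" using m by simp
        then have "Suc (E * m ^ t) \<le> (E + 1) * m ^ t" by (simp add: distrib_right)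
        then have "N \<le> real ((E + 1) * m ^ t)" unfolding N_def F'(2) of_nat_le_iff .
        then have "C * (t / m) ^ p * N \<le> C * (t / m) ^ p * real ((E + 1) * m ^ t)"
          using C by (intro mult_left_mono) auto
        also have "\<dots> = D * (real m ^ t / real m ^ p)"
          by (simp add: D_def power_divide algebra_simps)
        also have "real m ^ t / real m ^ p = 1 / real m ^ (t + 2)"
          using m p_eq by (simp add: power_add)
        finally show ?thesis by simp
      qed
      then have "C * (t / m) ^ p * N * B i \<le> D / real m ^ (t + 2) * B i"
        using Bi by (intro mult_right_mono) auto
      ultimately show False using \<open>A i > D / real m ^ (t + 2) * B i\<close> by linarith
    qed
  qed
qed

text \<open>The Dynin-Mityagin theorem. In |c_n| A_n = (|c_n| B_n) (A_n / B_n) the first factor is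
  bounded by \<open>coeff_estimate\<close> on the larger ball, and the quotients are summable by
  \<open>basis_counting\<close>.\<close>

lemma basis_absolute:
  fixes r :: real
  assumes r: "r \<ge> 0"
  obtains s C where "C > 0"
    "\<And>f c b. entire f \<Longrightarrow> represents c \<phi> f \<Longrightarrow> b > 0 \<Longrightarrow> ball_le s f b \<Longrightarrow>
       summable (\<lambda>n. norm (c n) * supnorm (cball 0 r) (\<phi> n)) \<and>
       (\<Sum>n. norm (c n) * supnorm (cball 0 r) (\<phi> n)) \<le> C * b"
proof (rule basis_counting[OF r])
  fix R D :: real and E t :: nat
  assume R: "R \<ge> r" and D: "D > 0" and
    count: "\<And>m F. m > 0 \<Longrightarrow> finite F \<Longrightarrow>
      (\<And>n. n \<in> F \<Longrightarrow> supnorm (cball 0 r) (\<phi> n) > D / real m ^ (t + 2) * supnorm (cball 0 R) (\<phi> n)) \<Longrightarrow>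
      card F \<le> E * m ^ t"
  define A B where "A n = supnorm (cball 0 r) (\<phi> n)" and "B n = supnorm (cball 0 R) (\<phi> n)" for n
  have R0: "R \<ge> 0" using R r by simp
  have A0: "A n \<ge> 0" for n unfolding A_def by (intro supnorm_nonneg entire_basis r)
  have AB: "A n \<le> B n" for n
    unfolding A_def B_def using R R0
    by (intro supnorm_le[where r = R] ball_le_supnorm supnorm_nonneg entire_basis) auto
  define w where "w n = A n / B n" for n
  have w0: "w n \<ge> 0" for n using A0[of n] AB[of n] by (simp add: w_def)
  have w1: "w n \<le> 1" for n using A0[of n] AB[of n] by (simp add: w_def divide_le_eq_1) linarith
  \<comment> \<open>If \<open>B n = 0\<close> then \<open>A n = 0\<close> as well, so division by 0
    does no harm.\<close>
  have Aw: "A n = w n * B n" for n using A0[of n] AB[of n] by (simp add: w_def)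
  have w: "summable w"
  proof (rule summable_of_counting_bound[OF w0 w1 D])
    fix m :: nat and F :: "nat set"
    assume "m > 0" "finite F" and F: "\<And>n. n \<in> F \<Longrightarrow> w n > D / real m ^ (t + 2)"
    have "A n > D / real m ^ (t + 2) * B n" if "n \<in> F" for n
    proof -
      have "D / real m ^ (t + 2) > 0" using D \<open>m > 0\<close> by simp
      with F[OF that] have "w n > 0" by linarith
      then have "B n > 0" using A0[of n] AB[of n] by (auto simp: w_def zero_less_divide_iff)
      with F[OF that] show ?thesis unfolding Aw[of n] by (intro mult_strict_right_mono)
    qed
    then show "card F \<le> E * m ^ t"
      using count[OF \<open>m > 0\<close> \<open>finite F\<close>] by (simp add: A_def B_def)
  qed
  show thesis
  proof (rule coeff_estimate[of R])
    fix s C :: real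
    assume C: "C > 0"
      "\<And>f c b n. entire f \<Longrightarrow> represents c \<phi> f \<Longrightarrow> b > 0 \<Longrightarrow> ball_le s f b \<Longrightarrow>
         ball_le R (\<lambda>z. c n * \<phi> n z) (C * b)"
    have W: "suminf w \<ge> 0" by (intro suminf_nonneg w w0)
    show thesis
    proof (rule that[of "C * (suminf w + 1)" s])
      show "C * (suminf w + 1) > 0" using C W by simp
      fix f :: "complex^'d \<Rightarrow> complex" and c and b :: real
      assume f: "entire f" "represents c \<phi> f" "b > 0" "ball_le s f b"
      have cB: "norm (c n) * B n \<le> C * b" for n
      proof (cases "c n = 0")
        case True
        then show ?thesis using C f by simp
      next
        case False
        have "B n \<le> C * b / norm (c n)"
          unfolding B_def
        proof (rule supnorm_le[OF _ order_refl])
          show "ball_le R (\<phi> n) (C * b / norm (c n))"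
            using C(2)[OF f, of n] False by (simp add: ball_le_def norm_mult pos_le_divide_eq mult.commute)
        qed (use C f in simp)
        then show ?thesis using False by (simp add: pos_le_divide_eq mult.commute)
      qed
      have le: "norm (c n) * A n \<le> C * b * w n" for n
        using mult_right_mono[OF cB[of n] w0[of n]] by (simp add: Aw[of n] mult_ac)
      have summ: "summable (\<lambda>n. norm (c n) * A n)"
        by (rule summable_comparison_test'[of "\<lambda>n. C * b * w n" 0])
          (use le A0 w in \<open>auto intro: summable_mult simp: abs_mult\<close>)
      have "(\<Sum>n. norm (c n) * A n) \<le> (\<Sum>n. C * b * w n)"
        by (intro suminf_le le summ summable_mult w)
      also have "\<dots> = C * suminf w * b" using w by (simp add: suminf_mult)
      also have "\<dots> \<le> C * (suminf w + 1) * b" using C f W by (intro mult_right_mono mult_left_mono) auto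
      finally show "summable (\<lambda>n. norm (c n) * supnorm (cball 0 r) (\<phi> n)) \<and>
        (\<Sum>n. norm (c n) * supnorm (cball 0 r) (\<phi> n)) \<le> C * (suminf w + 1) * b"
        using summ by (simp add: A_def)
    qed
  qed
qed

section \<open>The two implications between the Bohr property and a constant basis function\<close>

lemma constant_in_basis_if_global_bohr:
  assumes bohr: "global_bohr \<phi>"
  shows "\<exists>n a. \<forall>z. \<phi> n z = a"
proof -
  have one: "entire (\<lambda>z. 1)" by (rule entire_const)
  obtain c where c: "represents c \<phi> (\<lambda>z. 1)" using coeffs_exist[OF one] by blast
  have real: "c n * \<phi> n z \<in> \<real>" for n z
  proof -
    have "compact {z}" by simp
    from bohr[unfolded global_bohr_def, THEN spec, THEN mp, OF this] obtain K1 where K1: "{z} \<subseteq> K1" and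
      "\<forall>f c. entire f \<longrightarrow> represents c \<phi> f \<longrightarrow>
          summable (\<lambda>n. norm (c n) * supnorm {z} (\<phi> n)) \<and>
          (\<Sum>n. norm (c n) * supnorm {z} (\<phi> n)) \<le> supnorm K1 f"
      by (elim exE conjE)
    with one c have sum: "summable (\<lambda>n. norm (c n) * supnorm {z} (\<phi> n))"
        "(\<Sum>n. norm (c n) * supnorm {z} (\<phi> n)) \<le> supnorm K1 (\<lambda>z. 1)"
      by blast+
    define x where "x n = c n * \<phi> n z" for n
    have nx: "norm (c n) * supnorm {z} (\<phi> n) = norm (x n)" for n
      by (simp add: x_def supnorm_def norm_mult)
    \<comment> \<open>As \<open>z\<close> lies in \<open>K1\<close>, the default value 0 for the
      empty set does not occur.\<close>
    have "supnorm K1 (\<lambda>z. 1) = 1" using K1 by (auto simp: supnorm_def)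
    then have nsum: "summable (\<lambda>n. norm (x n))" "(\<Sum>n. norm (x n)) \<le> 1"
      using sum by (simp_all add: nx)
    have "(\<lambda>n. Re (x n)) sums 1"
      using bounded_linear.sums[OF bounded_linear_Re represents_sums[OF c, of z]] by (simp add: x_def)
    \<comment> \<open>Equality case of the triangle inequality: nonnegative terms with sum at most 0
      all vanish.\<close>
    then have diff: "(\<lambda>n. norm (x n) - Re (x n)) sums ((\<Sum>n. norm (x n)) - 1)"
      by (intro sums_diff summable_sums nsum)
    have nn: "norm (x n) - Re (x n) \<ge> 0" for n using complex_Re_le_cmod[of "x n"] by simp
    have "suminf (\<lambda>n. norm (x n) - Re (x n)) = 0"
      using diff nsum(2) suminf_nonneg[OF sums_summable[OF diff] nn] by (simp add: sums_iff)
    then have "norm (x n) - Re (x n) = 0"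
      using suminf_eq_zero_iff[OF sums_summable[OF diff] nn] by blast
    then have "Im (x n) = 0" using cmod_power2[of "x n"] by simp
    then show ?thesis by (simp add: x_def complex_is_Real_iff)
  qed
  have "\<exists>n. c n \<noteq> 0"
  proof (rule ccontr)
    assume "\<not> ?thesis"
    then show False using represents_sums[OF c, of 0] by (simp add: sums_iff)
  qed
  then obtain n where n: "c n \<noteq> 0" by blast
  have "c n * \<phi> n z = c n * \<phi> n 0" for z
    using real by (intro real_valued_entire_constant[where f = "\<lambda>z. c n * \<phi> n z"] entire_cmult entire_basis)
  with n have "\<phi> n z = \<phi> n 0" for z by simp
  then show ?thesis by blast
qed

lemma global_bohr_if_constant_in_basis:
  assumes k: "\<And>z. \<phi> k z = a"
  shows "global_bohr \<phi>"
  unfolding global_bohr_def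
proof (intro allI impI)
  fix K :: "(complex^'d) set" assume K: "compact K"
  then obtain r where r: "r \<ge> 0" "K \<subseteq> cball 0 r"
    using compact_imp_bounded[OF K] unfolding bounded_pos by (metis less_imp_le mem_cball_0 subsetI)
  have a: "a \<noteq> 0" using basis_nonzero[of k] k by simp
  show "\<exists>K1. compact K1 \<and> K \<subseteq> K1 \<and>
       (\<forall>f c. entire f \<longrightarrow> represents c \<phi> f \<longrightarrow>
          summable (\<lambda>n. norm (c n) * supnorm K (\<phi> n)) \<and>
          (\<Sum>n. norm (c n) * supnorm K (\<phi> n)) \<le> supnorm K1 f)"
  proof (rule basis_absolute[OF r(1)])
    fix s C :: real
    assume C: "C > 0" and
      absolute: "\<And>f c b. entire f \<Longrightarrow> represents c \<phi> f \<Longrightarrow> b > 0 \<Longrightarrow> ball_le s f b \<Longrightarrow>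
       summable (\<lambda>n. norm (c n) * supnorm (cball 0 r) (\<phi> n)) \<and>
       (\<Sum>n. norm (c n) * supnorm (cball 0 r) (\<phi> n)) \<le> C * b"
    \<comment> \<open>Borel-Caratheodory asks for a nonnegative radius, and \<open>s\<close> may be
      negative.\<close>
    define s' where "s' = max s 0"
    \<comment> \<open>The middle summand makes \<open>C\<close> times the Borel-Caratheodory factor
      at most 1, and the last one ensures \<open>s' < R\<close>.\<close>
    define R where "R = max r (s' + 2 * s' * C + 1)"
    have s': "s' \<ge> 0" "s \<le> s'" by (auto simp: s'_def)
    have "s' + 2 * s' * C + 1 \<le> R" "r \<le> R" by (simp_all add: R_def)
    moreover have "2 * s' * C \<ge> 0" using s' C by simp
    ultimately have R: "s' < R" "r \<le> R" "2 * s' * C \<le> R - s'" by linarith+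
    show ?thesis
    proof (intro exI[of _ "cball 0 R"] conjI allI impI)
      show "K \<subseteq> cball 0 R" using r R by force
      fix f c assume f: "entire f" "represents c \<phi> f"
      define M where "M = supnorm (cball 0 R) f"
      have M: "ball_le R f M" unfolding M_def using R s' by (intro ball_le_supnorm f) simp
      have fM: "norm (f 0) \<le> M" using ball_leD[OF M, of 0] R s' by simp
      define c' where "c' n = c n - (if n = k then f 0 / a else 0)" for n
      define g where "g z = f z - f 0" for z
      have g: "entire g" unfolding g_def by (intro entire_diff entire_const f)
      have "represents (\<lambda>n. if n = k then f 0 / a else 0) \<phi> (\<lambda>z. f 0)"
        using represents_finite[of "{k}" "\<lambda>n. if n = k then f 0 / a else 0" \<phi>] a by (simp add: k)
      from represents_diff[OF f(2) this] have c': "represents c' \<phi> g"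
        by (simp add: c'_def[abs_def] g_def[abs_def])
      define A where "A n = supnorm (cball 0 r) (\<phi> n)" for n
      have A0: "A n \<ge> 0" for n unfolding A_def by (intro supnorm_nonneg entire_basis r)
      have Ak: "A k = norm a" using r by (auto simp: A_def supnorm_def k)
      have gb: "ball_le s g (2 * s' / (R - s') * (M - norm (f 0)))"
        unfolding g_def using Borel_Caratheodory_entire[OF f(1) M s'(1) R(1)] s'(2)
        by (auto intro: ball_le_mono)
      have coef: "C * (2 * s' / (R - s')) \<le> 1"
        using R by (simp add: divide_le_eq mult_ac)
      have summ: "summable (\<lambda>n. norm (c' n) * A n)"
        and bound: "(\<Sum>n. norm (c' n) * A n) \<le> M - norm (f 0)"
      proof -
        \<comment> \<open>The absolute estimate needs a positive bound, whereas
          \<open>M - norm (f 0)\<close> may be 0; adding \<open>e / C\<close> there costs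
          \<open>e\<close> in the sum.\<close>
        have *: "summable (\<lambda>n. norm (c' n) * A n) \<and> (\<Sum>n. norm (c' n) * A n) \<le> M - norm (f 0) + e"
          if "e > 0" for e
        proof -
          have b: "2 * s' / (R - s') * (M - norm (f 0)) + e / C > 0"
            using s' R fM C \<open>e > 0\<close> by (intro add_nonneg_pos) auto
          have "ball_le s g (2 * s' / (R - s') * (M - norm (f 0)) + e / C)"
            using gb C \<open>e > 0\<close> by (auto intro: ball_le_mono)
          from absolute[OF g c' b this]
          have 1: "summable (\<lambda>n. norm (c' n) * A n)" and
            2: "(\<Sum>n. norm (c' n) * A n) \<le> C * (2 * s' / (R - s') * (M - norm (f 0)) + e / C)"
            by (simp_all only: A_def)
          have "C * (2 * s' / (R - s') * (M - norm (f 0)) + e / C)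
              = C * (2 * s' / (R - s')) * (M - norm (f 0)) + e"
            using C by (simp add: distrib_left)
          also have "\<dots> \<le> 1 * (M - norm (f 0)) + e"
            using coef fM by (intro add_right_mono mult_right_mono) auto
          finally show ?thesis using 1 2 by simp
        qed
        show "summable (\<lambda>n. norm (c' n) * A n)" using *[of 1] by simp
        show "(\<Sum>n. norm (c' n) * A n) \<le> M - norm (f 0)"
          by (rule field_le_epsilon) (use * in blast)
      qed
      \<comment> \<open>A majorant for the series of \<open>c\<close>: its extra term pays for the
        coefficient \<open>f 0 / a\<close> of the constant \<open>a\<close>, since
        \<open>norm (f 0 / a) * norm a = norm (f 0)\<close>.\<close>
      define h where "h n = norm (c' n) * A n + (if n = k then norm (f 0) else 0)" for n
      have h: "h sums ((\<Sum>n. norm (c' n) * A n) + norm (f 0))"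
        unfolding h_def by (intro sums_add summable_sums summ sums_single)
      have supK: "0 \<le> supnorm K (\<phi> n)" "supnorm K (\<phi> n) \<le> A n" for n
      proof -
        show "supnorm K (\<phi> n) \<le> A n"
          unfolding A_def by (intro supnorm_le[OF ball_le_supnorm] entire_basis r supnorm_nonneg)
        show "0 \<le> supnorm K (\<phi> n)"
        proof (cases "K = {}")
          case False
          then obtain w where w: "w \<in> K" by blast
          have "compact ((\<lambda>z. norm (\<phi> n z)) ` K)"
            by (intro compact_continuous_image continuous_on_norm entire_continuous_on entire_basis K)
          then have "bdd_above ((\<lambda>z. norm (\<phi> n z)) ` K)"
            by (intro bounded_imp_bdd_above compact_imp_bounded)
          with w have "norm (\<phi> n w) \<le> (SUP z\<in>K. norm (\<phi> n z))" by (intro cSUP_upper)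
          from order_trans[OF norm_ge_zero this] show ?thesis using False by (simp add: supnorm_def)
        qed (simp add: supnorm_def)
      qed
      have le: "norm (c n) * supnorm K (\<phi> n) \<le> h n" for n
      proof -
        have "norm (c n) * supnorm K (\<phi> n) \<le> norm (c n) * A n"
          by (intro mult_left_mono supK) simp
        also have "\<dots> \<le> h n"
        proof (cases "n = k")
          case True
          have "norm (c k) \<le> norm (c' k) + norm (f 0 / a)"
            using norm_triangle_ineq[of "c' k" "f 0 / a"] by (simp add: c'_def)
          then have "norm (c k) * norm a \<le> (norm (c' k) + norm (f 0 / a)) * norm a"
            by (intro mult_right_mono) auto
          then show ?thesis using a by (simp add: True h_def Ak distrib_right norm_divide)
        qed (simp add: h_def c'_def)
        finally show ?thesis .
      qed
      show summK: "summable (\<lambda>n. norm (c n) * supnorm K (\<phi> n))"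
        by (rule summable_comparison_test'[OF sums_summable[OF h], of 0])
          (use le supK in \<open>simp add: abs_mult\<close>)
      have "(\<Sum>n. norm (c n) * supnorm K (\<phi> n)) \<le> suminf h"
        by (intro suminf_le le summK sums_summable[OF h])
      also have "\<dots> \<le> M" using h bound by (simp add: sums_iff)
      finally show "(\<Sum>n. norm (c n) * supnorm K (\<phi> n)) \<le> supnorm (cball 0 R) f"
        by (simp add: M_def)
    qed simp
  qed
qed

end

theorem mainTheorem2:
  fixes \<phi> :: "nat \<Rightarrow> complex^'d \<Rightarrow> complex"
  assumes "is_basis \<phi>"
  shows "global_bohr \<phi> \<longleftrightarrow> (\<exists>n a. \<forall>z. \<phi> n z = a)"
proof -
  interpret entire_basis \<phi> by unfold_locales (rule assms)
  show ?thesis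
    using constant_in_basis_if_global_bohr global_bohr_if_constant_in_basis by blast
qed

end
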